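(* Let $E$ be a real Hausdorff infrabarreled locally convex space and $\mathcal{K}\subset E$ a pointed cone. The following are equivalent. (i) There exist $x^*\in\mathcal{K}^*$ and $\lambda>0$ such that $\{x\in E:x^*(x)\le\lambda\}\cap\mathcal{K}$ is $\beta(E,E^* )$-bounded. (ii) $0\in\beta(E,E^* )\text{-bPC}(\mathcal{K})$ and $\widehat{\mathcal{K}}$ is pointed. (iii) $0\in\beta(E,E^* )\text{-bPC}(\mathcal{K})\cap\sigma(E,E^* )\text{-s-ext}(\mathcal{K})$. (iv) $0\in\beta(E,E^* )\text{-bPC}(\mathcal{K})$ and $\mathcal{K}^{**}$ is pointed. (v) $0\in\beta(E,E^* )\text{-bPC}(\mathcal{K})$ and $\mathrm{span}(\mathcal{K}^* )$ is $\beta(E^*,E)$-dense in $E^*$. (vi) There exist $n\ge1$, $x_i^*\in\mathcal{K}^*$ for $i\in\{1,\dots,n\}$, and $\lambda>0$ such that $\bigcap_{i=1}^n\{x\in E:x_i^*(x)<\lambda\}\cap\mathcal{K}$ is $\beta(E,E^* )$-bounded.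
   Context: $(E,\tau)$ is a real Hausdorff locally convex space with dual $E^*$. $E$ is infrabarreled if every barrel (closed, convex, balanced, absorbent set) in $E$ which absorbs all bounded sets is a neighbourhood of $0$. $\beta(E^*,E)$ is the topology on $E^*$ of uniform convergence on bounded subsets of $E$; $E^{**}$ is the dual of $(E^*,\beta(E^*,E))$; $\beta(E^{**},E^* )$ is the topology on $E^{**}$ of uniform convergence on $\beta(E^*,E)$-bounded subsets of $E^*$. $\beta(E,E^* )$ is the strong topology on $E$: the locally convex topology having the barrels of $E$ as a base of neighbourhoods of $0$ (equivalently, uniform convergence on $\sigma(E^*,E)$-bounded subsets of $E^*$). $J_E:E\to E^{**}$ is the canonical map and $\widehat{\mathcal{K}}$ is the $\beta(E^{**},E^* )$-closure of $J_E(\mathcal{K})$ in $E^{**}$. A cone $\mathcal{K}$ is a (nonempty) convex set with $\lambda k\in\mathcal{K}$ for all $\lambda\ge0$, $k\in\mathcal{K}$; it is pointed if $\mathcal{K}\cap(-\mathcal{K})=\{0\}$. $\mathcal{K}^*=\{x^*\in E^*: x^*(k)\ge0\ \forall k\in\mathcal{K}\}$ and $\mathcal{K}^{**}=\{x^{**}\in E^{**}: x^{**}(x^* )\ge0\ \forall x^*\in\mathcal{K}^*\}$. $0\in\beta(E,E^* )\text{-bPC}(\mathcal{K})$ means there is a $\sigma(E,E^* )$-neighbourhood $W$ of $0$ such that $\mathcal{K}\cap W$ is $\beta(E,E^* )$-bounded. $0\in\sigma(E,E^* )\text{-s-ext}(\mathcal{K})$ means: for all nets $(c_\gamma)_{\gamma\in\Gamma},(c'_\gamma)_{\gamma\in\Gamma}$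 in $\mathcal{K}$ with $\lim_\gamma\frac{c_\gamma+c'_\gamma}{2}=0$ in $\tau$, one has $\lim_\gamma c_\gamma=0$ in $\sigma(E,E^* )$. *)

theory Defs
  imports "HOL-Analysis.Analysis"
begin

subsection \<open>Locally convex spaces\<close>

text \<open>A real Hausdorff locally convex space. In the last axiom the convexity of \<open>V\<close> is written
  out, because the constant \<open>convex\<close> cannot occur in a class specification.\<close>

class locally_convex_t2 = real_vector + topological_ab_group_add + t2_space +
  assumes tendsto_scaleR_nhds:
      "((\<lambda>p. fst p *\<^sub>R snd p) \<longlongrightarrow> r *\<^sub>R x) (nhds (r::real) \<times>\<^sub>F nhds x)"
    and ex_open_convex:
      "open U \<Longrightarrow> 0 \<in> U \<Longrightarrow> \<exists>V. open V \<and> 0 \<in> V \<and> V \<subseteq> U \<and>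
        (\<forall>x\<in>V. \<forall>y\<in>V. \<forall>u\<ge>0. \<forall>v\<ge>0. u + v = 1 \<longrightarrow> u *\<^sub>R x + v *\<^sub>R y \<in> V)"

lemma locally_convex:
  fixes U :: "'a::locally_convex_t2 set"
  assumes "open U" "0 \<in> U"
  shows "\<exists>V. open V \<and> 0 \<in> V \<and> V \<subseteq> U \<and> convex V"
  using ex_open_convex[OF assms] unfolding convex_def by blast

definition absorbs :: "'a::real_vector set \<Rightarrow> 'a set \<Rightarrow> bool"
  where "absorbs U S \<longleftrightarrow> (\<exists>r>0. \<forall>t::real. r \<le> \<bar>t\<bar> \<longrightarrow> S \<subseteq> (\<lambda>x. t *\<^sub>R x) ` U)"

definition absorbent :: "'a::real_vector set \<Rightarrow> bool"
  where "absorbent U \<longleftrightarrow> (\<forall>x. absorbs U {x})"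

definition balanced :: "'a::real_vector set \<Rightarrow> bool"
  where "balanced U \<longleftrightarrow> (\<forall>x\<in>U. \<forall>t::real. \<bar>t\<bar> \<le> 1 \<longrightarrow> t *\<^sub>R x \<in> U)"

text \<open>Boundedness in the von Neumann sense. The topology is an explicit argument because the
  same space is used with its given, its weak and its strong topology.\<close>

definition bounded_wrt :: "'a::real_vector topology \<Rightarrow> 'a set \<Rightarrow> bool"
  where "bounded_wrt T S \<longleftrightarrow> (\<forall>U. openin T U \<and> 0 \<in> U \<longrightarrow> absorbs U S)"

definition barrel :: "'a::locally_convex_t2 set \<Rightarrow> bool"
  where "barrel B \<longleftrightarrow> closed B \<and> convex B \<and> balanced B \<and> absorbent B"

definition infrabarreled :: "'a::locally_convex_t2 itself \<Rightarrow> bool"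
  where "infrabarreled _ \<longleftrightarrow>
    (\<forall>B::'a set. barrel B \<and> (\<forall>S. bounded_wrt euclidean S \<longrightarrow> absorbs B S) \<longrightarrow> 0 \<in> interior B)"

lemma tendsto_scaleR_lcs:
  fixes g :: "'b \<Rightarrow> 'a::locally_convex_t2" and f :: "'b \<Rightarrow> real"
  assumes "(f \<longlongrightarrow> r) F" "(g \<longlongrightarrow> x) F"
  shows "((\<lambda>i. f i *\<^sub>R g i) \<longlongrightarrow> r *\<^sub>R x) F"
  using filterlim_compose[OF tendsto_scaleR_nhds filterlim_Pair[OF assms]] by simp

lemma open_absorbent:
  fixes U :: "'a::locally_convex_t2 set"
  assumes "open U" "0 \<in> U"
  shows "absorbent U"
  unfolding absorbent_def absorbs_def
proof
  fix x :: 'a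
  have "((\<lambda>s::real. s *\<^sub>R x) \<longlongrightarrow> 0 *\<^sub>R x) (nhds 0)"
    by (intro tendsto_scaleR_lcs tendsto_const filterlim_ident)
  then have "eventually (\<lambda>s::real. s *\<^sub>R x \<in> U) (nhds 0)"
    using assms by (auto simp: tendsto_def)
  then obtain d where d: "d > 0" "\<And>s::real. \<bar>s\<bar> < d \<Longrightarrow> s *\<^sub>R x \<in> U"
    unfolding eventually_nhds_metric by (auto simp: dist_real_def)
  show "\<exists>r>0. \<forall>t. r \<le> \<bar>t\<bar> \<longrightarrow> {x} \<subseteq> (\<lambda>x. t *\<^sub>R x) ` U"
  proof (intro exI conjI allI impI)
    show "2 / d > 0" using d by simp
    fix t :: real assume t: "2 / d \<le> \<bar>t\<bar>"
    then have t0: "t \<noteq> 0" using d(1) by (auto simp: field_simps)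
    have "\<bar>inverse t\<bar> < d"
      using t t0 d(1) by (simp add: field_simps abs_inverse)
    then have "inverse t *\<^sub>R x \<in> U" by (rule d(2))
    then show "{x} \<subseteq> (\<lambda>x. t *\<^sub>R x) ` U"
      using t0 by (auto intro!: image_eqI[where x="inverse t *\<^sub>R x"])
  qed
qed

lemma bounded_wrt_singleton: "bounded_wrt euclidean {x::'a::locally_convex_t2}"
  using open_absorbent by (auto simp: bounded_wrt_def absorbent_def)

lemma bounded_wrt_empty: "bounded_wrt T {}"
  by (auto simp: bounded_wrt_def absorbs_def intro: exI[of _ 1])

lemma bounded_wrt_Un:
  assumes "bounded_wrt T A" "bounded_wrt T B"
  shows "bounded_wrt T (A \<union> B)"
  unfolding bounded_wrt_def
proof (intro allI impI)
  fix U assume U: "openin T U \<and> 0 \<in> U"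
  obtain r s where
    "r > 0" "\<forall>t::real. r \<le> \<bar>t\<bar> \<longrightarrow> A \<subseteq> (\<lambda>x. t *\<^sub>R x) ` U"
    "s > 0" "\<forall>t::real. s \<le> \<bar>t\<bar> \<longrightarrow> B \<subseteq> (\<lambda>x. t *\<^sub>R x) ` U"
    using assms U unfolding bounded_wrt_def absorbs_def by meson
  then show "absorbs U (A \<union> B)"
    unfolding absorbs_def by (intro exI[of _ "max r s"]) auto
qed


subsection \<open>The dual space with the strong topology\<close>

typedef (overloaded) 'a dual =
  "{f :: 'a::locally_convex_t2 \<Rightarrow> real. linear f \<and> continuous_on UNIV f}"
  morphisms app Dual
proof
  show "(\<lambda>_. 0) \<in> {f :: 'a \<Rightarrow> real. linear f \<and> continuous_on UNIV f}"
    by (simp add: linear_iff)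
qed

setup_lifting type_definition_dual

lemma linear_app: "linear (app f)"
  and continuous_on_app: "continuous_on UNIV (app f)"
  using app[of f] by auto

lemma app_inject_ext: "(\<And>x. app f x = app g x) \<Longrightarrow> f = g"
  using app_inject by blast

instantiation dual :: (locally_convex_t2) real_vector
begin

lift_definition zero_dual :: "'a dual" is "\<lambda>_. 0" by (simp add: linear_iff)
lift_definition plus_dual :: "'a dual \<Rightarrow> 'a dual \<Rightarrow> 'a dual" is "\<lambda>f g x. f x + g x"
  by (auto intro!: continuous_intros simp: linear_iff algebra_simps)
lift_definition minus_dual :: "'a dual \<Rightarrow> 'a dual \<Rightarrow> 'a dual" is "\<lambda>f g x. f x - g x"
  by (auto intro!: continuous_intros simp: linear_iff algebra_simps)
lift_definition uminus_dual :: "'a dual \<Rightarrow> 'a dual" is "\<lambda>f x. - f x"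
  by (auto intro!: continuous_intros simp: linear_iff algebra_simps)
lift_definition scaleR_dual :: "real \<Rightarrow> 'a dual \<Rightarrow> 'a dual" is "\<lambda>r f x. r * f x"
  by (auto intro!: continuous_intros simp: linear_iff algebra_simps)

instance
  by standard (transfer; auto simp: algebra_simps)+

end

lemmas app_simps [simp] =
  zero_dual.rep_eq plus_dual.rep_eq minus_dual.rep_eq uminus_dual.rep_eq scaleR_dual.rep_eq

text \<open>The type \<open>'a dual\<close> always carries \<open>\<beta>(E\<^sup>*, E)\<close>, the topology of uniform convergence on
  bounded sets. Consequently \<open>'a dual dual\<close> is the bidual \<open>E\<^sup>*\<^sup>*\<close> with \<open>\<beta>(E\<^sup>*\<^sup>*, E\<^sup>*)\<close>.\<close>

instantiation dual :: (locally_convex_t2) topological_space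
begin

definition open_dual :: "'a dual set \<Rightarrow> bool"
  where "open_dual U \<longleftrightarrow> (\<forall>f\<in>U. \<exists>S e. bounded_wrt euclidean S \<and> e > 0 \<and>
    {g. \<forall>x\<in>S. \<bar>app g x - app f x\<bar> < e} \<subseteq> U)"

instance
proof
  show "open (UNIV :: 'a dual set)"
    unfolding open_dual_def using bounded_wrt_empty zero_less_one by blast
next
  fix U V :: "'a dual set"
  assume UV: "open U" "open V"
  show "open (U \<inter> V)"
    unfolding open_dual_def
  proof
    fix f assume f: "f \<in> U \<inter> V"
    obtain S e where 1: "bounded_wrt euclidean S" "e > 0"
        "{g. \<forall>x\<in>S. \<bar>app g x - app f x\<bar> < e} \<subseteq> U"
      using UV(1) f unfolding open_dual_def by blast
    obtain S' e' where 2: "bounded_wrt euclidean S'" "e' > 0"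
        "{g. \<forall>x\<in>S'. \<bar>app g x - app f x\<bar> < e'} \<subseteq> V"
      using UV(2) f unfolding open_dual_def by blast
    show "\<exists>S e. bounded_wrt euclidean S \<and> e > 0 \<and>
        {g. \<forall>x\<in>S. \<bar>app g x - app f x\<bar> < e} \<subseteq> U \<inter> V"
      using 1 2 by (intro exI[of _ "S \<union> S'"] exI[of _ "min e e'"]) (auto simp: bounded_wrt_Un)
  qed
next
  fix K :: "'a dual set set"
  assume "\<forall>U\<in>K. open U"
  then show "open (\<Union>K)"
    unfolding open_dual_def by (meson UnionE Union_upper order_trans)
qed

end

lemma open_dual_ball:
  fixes f :: "'a::locally_convex_t2 dual"
  assumes "bounded_wrt euclidean S"
  shows "open {g. \<exists>d<e. \<forall>x\<in>S. \<bar>app g x - app f x\<bar> \<le> d}"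
  unfolding open_dual_def
proof
  fix g assume "g \<in> {g. \<exists>d<e. \<forall>x\<in>S. \<bar>app g x - app f x\<bar> \<le> d}"
  then obtain d where d: "d < e" "\<forall>x\<in>S. \<bar>app g x - app f x\<bar> \<le> d" by auto
  have "{h. \<forall>x\<in>S. \<bar>app h x - app g x\<bar> < (e - d) / 2}
      \<subseteq> {g. \<exists>d<e. \<forall>x\<in>S. \<bar>app g x - app f x\<bar> \<le> d}"
  proof clarify
    fix h assume h: "\<forall>x\<in>S. \<bar>app h x - app g x\<bar> < (e - d) / 2"
    have "\<bar>app h x - app f x\<bar> \<le> (e + d) / 2" if "x \<in> S" for x
      using bspec[OF d(2) that] bspec[OF h that] by (simp add: field_simps abs_if split: if_splits)
    then show "\<exists>d<e. \<forall>x\<in>S. \<bar>app h x - app f x\<bar> \<le> d"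
      using d(1) by (intro exI[of _ "(e + d) / 2"]) auto
  qed
  then show "\<exists>S' e'. bounded_wrt euclidean S' \<and> e' > 0 \<and>
      {h. \<forall>x\<in>S'. \<bar>app h x - app g x\<bar> < e'} \<subseteq> {g. \<exists>d<e. \<forall>x\<in>S. \<bar>app g x - app f x\<bar> \<le> d}"
    using assms d(1) by (intro exI[of _ S] exI[of _ "(e - d) / 2"]) auto
qed

lemma eventually_nhds_dual:
  fixes f :: "'a::locally_convex_t2 dual"
  shows "eventually P (nhds f) \<longleftrightarrow> (\<exists>S e. bounded_wrt euclidean S \<and> e > 0 \<and>
    (\<forall>g. (\<forall>x\<in>S. \<bar>app g x - app f x\<bar> < e) \<longrightarrow> P g))"
proof
  assume "eventually P (nhds f)"
  then obtain U where U: "open U" "f \<in> U" "\<forall>g\<in>U. P g"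
    unfolding eventually_nhds by blast
  then obtain S e where "bounded_wrt euclidean S" "e > 0"
      "{g. \<forall>x\<in>S. \<bar>app g x - app f x\<bar> < e} \<subseteq> U"
    unfolding open_dual_def by blast
  with U(3) show "\<exists>S e. bounded_wrt euclidean S \<and> e > 0 \<and>
      (\<forall>g. (\<forall>x\<in>S. \<bar>app g x - app f x\<bar> < e) \<longrightarrow> P g)"
    by (intro exI[of _ S] exI[of _ e]) auto
next
  assume "\<exists>S e. bounded_wrt euclidean S \<and> e > 0 \<and>
    (\<forall>g. (\<forall>x\<in>S. \<bar>app g x - app f x\<bar> < e) \<longrightarrow> P g)"
  then obtain S e where S: "bounded_wrt euclidean S" "e > 0"
    "\<And>g. (\<forall>x\<in>S. \<bar>app g x - app f x\<bar> < e) \<Longrightarrow> P g" by blast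
  show "eventually P (nhds f)"
    unfolding eventually_nhds
  proof (intro exI conjI ballI)
    show "open {g. \<exists>d<e. \<forall>x\<in>S. \<bar>app g x - app f x\<bar> \<le> d}"
      using S(1) by (rule open_dual_ball)
    show "f \<in> {g. \<exists>d<e. \<forall>x\<in>S. \<bar>app g x - app f x\<bar> \<le> d}"
      using S(2) by (auto intro: exI[of _ 0])
    show "P g" if "g \<in> {g. \<exists>d<e. \<forall>x\<in>S. \<bar>app g x - app f x\<bar> \<le> d}" for g
      using that by (intro S(3)) fastforce
  qed
qed

lemma app_bounded:
  fixes f :: "'a::locally_convex_t2 dual"
  assumes "bounded_wrt euclidean S"
  obtains M where "M > 0" "\<And>x. x \<in> S \<Longrightarrow> \<bar>app f x\<bar> < M"
proof -
  have "open (app f -` {-1<..<1})"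
    using continuous_on_app[of f] by (intro open_vimage) auto
  moreover have "0 \<in> app f -` {-1<..<1}"
    using linear_0[OF linear_app[of f]] by simp
  ultimately obtain r where r: "r > 0" "S \<subseteq> (\<lambda>x. r *\<^sub>R x) ` (app f -` {-1<..<1})"
    using assms unfolding bounded_wrt_def absorbs_def
    by (metis abs_of_pos open_openin order_refl)
  have "\<bar>app f x\<bar> < r" if "x \<in> S" for x
  proof -
    obtain y where y: "x = r *\<^sub>R y" "y \<in> app f -` {-1<..<1}"
      using subsetD[OF r(2) \<open>x \<in> S\<close>] by (rule imageE)
    then have "\<bar>app f y\<bar> < 1" by auto
    moreover
    have "app f x = r * app f y"
      using y(1) linear_cmul[OF linear_app[of f]] by simp
    ultimately show ?thesis using r(1) by (simp add: abs_mult)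
  qed
  with r(1) that show ?thesis by blast
qed

instance dual :: (locally_convex_t2) locally_convex_t2
proof
  fix f g :: "'a dual"
  show "filterlim (\<lambda>p. fst p + snd p) (nhds (f + g)) (nhds f \<times>\<^sub>F nhds g)"
    unfolding filterlim_iff
  proof (intro allI impI)
    fix P assume "eventually P (nhds (f + g))"
    then obtain S e where S: "bounded_wrt euclidean S" "e > 0"
        "\<And>h. (\<forall>x\<in>S. \<bar>app h x - app (f + g) x\<bar> < e) \<Longrightarrow> P h"
      unfolding eventually_nhds_dual by blast
    let ?Q = "\<lambda>k h. \<forall>x\<in>S. \<bar>app h x - app k x\<bar> < e / 2"
    have Q: "eventually (?Q k) (nhds k)" for k
      unfolding eventually_nhds_dual using S by (intro exI[of _ S] exI[of _ "e / 2"]) auto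
    have "P (h + k)" if "?Q f h" "?Q g k" for h k
    proof (rule S(3), rule ballI)
      fix x assume "x \<in> S"
      then show "\<bar>app (h + k) x - app (f + g) x\<bar> < e"
        using bspec[OF that(1)] bspec[OF that(2)] by (fastforce simp: abs_if split: if_splits)
    qed
    then show "eventually (\<lambda>p. P (fst p + snd p)) (nhds f \<times>\<^sub>F nhds g)"
      unfolding eventually_prod_filter using Q by (intro exI[of _ "?Q f"] exI[of _ "?Q g"]) auto
  qed
next
  fix f :: "'a dual"
  show "(uminus \<longlongrightarrow> - f) (nhds f)"
    unfolding filterlim_iff
  proof (intro allI impI)
    fix P assume "eventually P (nhds (- f))"
    then obtain S e where S: "bounded_wrt euclidean S" "e > 0"
        "\<And>h. (\<forall>x\<in>S. \<bar>app h x - app (- f) x\<bar> < e) \<Longrightarrow> P h"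
      unfolding eventually_nhds_dual by blast
    show "eventually (\<lambda>h. P (- h)) (nhds f)"
      unfolding eventually_nhds_dual
    proof (intro exI conjI allI impI)
      fix h assume "\<forall>x\<in>S. \<bar>app h x - app f x\<bar> < e"
      then show "P (- h)" by (intro S(3)) (auto simp: abs_minus_commute)
    qed (use S in auto)
  qed
next
  fix f g :: "'a dual"
  assume "f \<noteq> g"
  then obtain x where x: "app f x \<noteq> app g x" using app_inject_ext by blast
  define e where "e = \<bar>app f x - app g x\<bar> / 2"
  let ?B = "\<lambda>k. {h. \<exists>d<e. \<forall>y\<in>{x}. \<bar>app h y - app k y\<bar> \<le> d}"
  have "open (?B k)" for k
    by (rule open_dual_ball[OF bounded_wrt_singleton])
  moreover have "k \<in> ?B k" for k using x by (auto simp: e_def intro!: exI[of _ 0])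
  moreover have "?B f \<inter> ?B g = {}" by (auto simp: e_def)
  ultimately show "\<exists>U V. open U \<and> open V \<and> f \<in> U \<and> g \<in> V \<and> U \<inter> V = {}"
    by (intro exI[of _ "?B f"] exI[of _ "?B g"]) simp
next
  fix r :: real and f :: "'a dual"
  show "((\<lambda>p. fst p *\<^sub>R snd p) \<longlongrightarrow> r *\<^sub>R f) (nhds r \<times>\<^sub>F nhds f)"
    unfolding filterlim_iff
  proof (intro allI impI)
    fix P assume "eventually P (nhds (r *\<^sub>R f))"
    then obtain S e where S: "bounded_wrt euclidean S" "e > 0"
        "\<And>h. (\<forall>x\<in>S. \<bar>app h x - app (r *\<^sub>R f) x\<bar> < e) \<Longrightarrow> P h"
      unfolding eventually_nhds_dual by blast
    obtain M where M: "M > 0" "\<And>x. x \<in> S \<Longrightarrow> \<bar>app f x\<bar> < M"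
      using app_bounded[OF S(1)] by blast
    define a where "a = min 1 (e / (2 * M))"
    define b where "b = e / (2 * (\<bar>r\<bar> + 1))"
    have ab: "a > 0" "b > 0" using S(2) M(1) by (auto simp: a_def b_def intro!: divide_pos_pos)
    let ?P = "\<lambda>t. \<bar>t - r\<bar> < a" and ?Q = "\<lambda>h. \<forall>x\<in>S. \<bar>app h x - app f x\<bar> < b"
    have "eventually ?P (nhds r)"
      unfolding eventually_nhds_metric using ab by (auto simp: dist_real_def)
    moreover have "eventually ?Q (nhds f)"
      unfolding eventually_nhds_dual using S ab by blast
    moreover have "P (t *\<^sub>R h)" if t: "?P t" and h: "?Q h" for t h
    proof (rule S(3), rule ballI)
      fix x assume x: "x \<in> S"
      have eq: "app (t *\<^sub>R h) x - app (r *\<^sub>R f) x = t * (app h x - app f x) + (t - r) * app f x"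
        by (simp add: algebra_simps)
      have "\<bar>t\<bar> \<le> \<bar>r\<bar> + 1" using t by (auto simp: a_def)
      then have "\<bar>t\<bar> * \<bar>app h x - app f x\<bar> \<le> (\<bar>r\<bar> + 1) * \<bar>app h x - app f x\<bar>"
        by (intro mult_right_mono) auto
      also have "\<dots> < (\<bar>r\<bar> + 1) * b"
        using bspec[OF h x] by (intro mult_strict_left_mono) auto
      also have "\<dots> = e / 2" by (simp add: b_def divide_simps)
      finally have 1: "\<bar>t * (app h x - app f x)\<bar> < e / 2" by (simp add: abs_mult)
      have "\<bar>t - r\<bar> * \<bar>app f x\<bar> \<le> (e / (2 * M)) * M"
        using t M(2)[OF x] S(2) M(1) by (intro mult_mono) (auto simp: a_def)
      also have "\<dots> = e / 2" using M(1) by simp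
      finally have 2: "\<bar>(t - r) * app f x\<bar> \<le> e / 2" by (simp add: abs_mult)
      show "\<bar>app (t *\<^sub>R h) x - app (r *\<^sub>R f) x\<bar> < e"
        unfolding eq using 1 2 by linarith
    qed
    ultimately show "eventually (\<lambda>p. P (fst p *\<^sub>R snd p)) (nhds r \<times>\<^sub>F nhds f)"
      unfolding eventually_prod_filter by (intro exI[of _ ?P] exI[of _ ?Q]) auto
  qed
next
  fix U :: "'a dual set"
  assume "open U" "0 \<in> U"
  then obtain S e where S: "bounded_wrt euclidean S" "e > 0"
      "{g. \<forall>x\<in>S. \<bar>app g x - app 0 x\<bar> < e} \<subseteq> U"
    unfolding open_dual_def by blast
  let ?V = "{g::'a dual. \<exists>d<e. \<forall>x\<in>S. \<bar>app g x - app 0 x\<bar> \<le> d}"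
  have "u *\<^sub>R g + v *\<^sub>R h \<in> ?V"
    if gh: "g \<in> ?V" "h \<in> ?V" and uv: "u \<ge> 0" "v \<ge> 0" "u + v = 1" for g h u v
  proof -
    obtain c d where cd: "c < e" "\<forall>x\<in>S. \<bar>app g x\<bar> \<le> c" "d < e" "\<forall>x\<in>S. \<bar>app h x\<bar> \<le> d"
      using gh by auto
    have "\<bar>app (u *\<^sub>R g + v *\<^sub>R h) x\<bar> \<le> max c d" if "x \<in> S" for x
    proof -
      have "\<bar>app (u *\<^sub>R g + v *\<^sub>R h) x\<bar> \<le> u * \<bar>app g x\<bar> + v * \<bar>app h x\<bar>"
        using uv abs_triangle_ineq[of "u * app g x" "v * app h x"] by (simp add: abs_mult)
      also have "\<dots> \<le> u * max c d + v * max c d"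
        using cd(2,4) that uv by (intro add_mono mult_left_mono) (auto simp: le_max_iff_disj)
      also have "\<dots> = max c d" using uv by (simp add: distrib_right[symmetric])
      finally show ?thesis .
    qed
    then show ?thesis using cd by (auto intro!: exI[of _ "max c d"])
  qed
  moreover have "open ?V" by (rule open_dual_ball[OF S(1)])
  moreover have "0 \<in> ?V" using S(2) by (auto intro: exI[of _ 0])
  moreover have "?V \<subseteq> U"
  proof
    fix g assume "g \<in> ?V"
    then have "\<forall>x\<in>S. \<bar>app g x - app 0 x\<bar> < e" by fastforce
    then show "g \<in> U" using S(3) by blast
  qed
  ultimately show "\<exists>V. open V \<and> 0 \<in> V \<and> V \<subseteq> U \<and>
      (\<forall>x\<in>V. \<forall>y\<in>V. \<forall>u\<ge>0. \<forall>v\<ge>0. u + v = 1 \<longrightarrow> u *\<^sub>R x + v *\<^sub>R y \<in> V)"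
    by (intro exI[of _ ?V] conjI ballI allI impI)
qed

text \<open>The canonical map \<open>J\<^sub>E : E \<rightarrow> E\<^sup>*\<^sup>*\<close>.\<close>

lift_definition canonical :: "'a::locally_convex_t2 \<Rightarrow> 'a dual dual" is "\<lambda>x f. app f x"
proof
  fix x :: 'a
  show "linear (\<lambda>f. app f x)" by (simp add: linear_iff)
  have "isCont (\<lambda>f. app f x) f" for f :: "'a dual"
    unfolding continuous_at tendsto_iff
  proof (intro allI impI)
    fix e :: real assume "e > 0"
    then have "eventually (\<lambda>g. dist (app g x) (app f x) < e) (nhds f)"
      unfolding eventually_nhds_dual dist_real_def using bounded_wrt_singleton[of x] by blast
    then show "eventually (\<lambda>g. dist (app g x) (app f x) < e) (at f)"
      by (simp add: eventually_at_filter eventually_mono)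
  qed
  then show "continuous_on UNIV (\<lambda>f. app f x)"
    by (simp add: continuous_at_imp_continuous_on)
qed


subsection \<open>The weak and the strong topology of the original space\<close>

text \<open>\<open>\<sigma>(E, E\<^sup>*)\<close>\<close>

definition weak_topology :: "'a::locally_convex_t2 topology"
  where "weak_topology = topology_generated_by {app f -` V | f V. open V}"

text \<open>\<open>\<beta>(E, E\<^sup>*)\<close>, the translation invariant topology in which the barrels form a base of
  neighbourhoods of \<open>0\<close>; see \<open>openin_strong_topology\<close> and \<open>barrel_strong_nhd\<close> below.\<close>

definition strong_topology :: "'a::locally_convex_t2 topology"
  where "strong_topology = topology (\<lambda>U. \<forall>x\<in>U. \<exists>B. barrel B \<and> (\<lambda>y. x + y) ` B \<subseteq> U)"

lemma barrel_UNIV: "barrel (UNIV :: 'a::locally_convex_t2 set)"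
  using open_absorbent[of UNIV] by (simp add: barrel_def balanced_def)

lemma barrel_Int:
  assumes "barrel A" "barrel B"
  shows "barrel (A \<inter> B)"
proof -
  have "absorbs (A \<inter> B) {x}" for x
  proof -
    obtain r s where
      "r > 0" "\<forall>t::real. r \<le> \<bar>t\<bar> \<longrightarrow> {x} \<subseteq> (\<lambda>x. t *\<^sub>R x) ` A"
      "s > 0" "\<forall>t::real. s \<le> \<bar>t\<bar> \<longrightarrow> {x} \<subseteq> (\<lambda>x. t *\<^sub>R x) ` B"
      using assms unfolding barrel_def absorbent_def absorbs_def by meson
    moreover have "{x} \<subseteq> (\<lambda>x. t *\<^sub>R x) ` (A \<inter> B)"
      if "{x} \<subseteq> (\<lambda>x. t *\<^sub>R x) ` A" "{x} \<subseteq> (\<lambda>x. t *\<^sub>R x) ` B" "t \<noteq> 0" for t :: real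
      using that by auto
    ultimately show ?thesis
      unfolding absorbs_def by (intro exI[of _ "max r s"]) auto
  qed
  then show ?thesis
    using assms by (auto simp: barrel_def absorbent_def balanced_def convex_Int closed_Int)
qed

lemma openin_strong_topology:
  "openin strong_topology U \<longleftrightarrow> (\<forall>x\<in>U. \<exists>B. barrel B \<and> (\<lambda>y. x + y) ` B \<subseteq> U)"
proof -
  have "istopology (\<lambda>U :: 'a set. \<forall>x\<in>U. \<exists>B. barrel B \<and> (\<lambda>y. x + y) ` B \<subseteq> U)"
    unfolding istopology_def
  proof (intro conjI allI impI ballI)
    fix U V :: "'a set" and x
    assume "\<forall>x\<in>U. \<exists>B. barrel B \<and> (\<lambda>y. x + y) ` B \<subseteq> U"
      "\<forall>x\<in>V. \<exists>B. barrel B \<and> (\<lambda>y. x + y) ` B \<subseteq> V" "x \<in> U \<inter> V"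
    then obtain A B where "barrel A" "(\<lambda>y. x + y) ` A \<subseteq> U" "barrel B" "(\<lambda>y. x + y) ` B \<subseteq> V"
      by blast
    then show "\<exists>B. barrel B \<and> (\<lambda>y. x + y) ` B \<subseteq> U \<inter> V"
      by (intro exI[of _ "A \<inter> B"]) (auto simp: barrel_Int)
  next
    fix \<U> :: "'a set set" and x
    assume "\<forall>U\<in>\<U>. \<forall>x\<in>U. \<exists>B. barrel B \<and> (\<lambda>y. x + y) ` B \<subseteq> U" "x \<in> \<Union>\<U>"
    then show "\<exists>B. barrel B \<and> (\<lambda>y. x + y) ` B \<subseteq> \<Union>\<U>" by (meson UnionE Union_upper order_trans)
  qed
  then show ?thesis unfolding strong_topology_def by (simp add: topology_inverse')
qed

lemma topspace_strong_topology [simp]: "topspace strong_topology = UNIV"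
  using openin_subset[of strong_topology UNIV] barrel_UNIV
  by (auto simp: openin_strong_topology)

lemma barrel_scaleR:
  assumes "barrel B" "c > (0::real)"
  shows "barrel ((\<lambda>x. c *\<^sub>R x) ` B)"
proof -
  have im: "(\<lambda>x. c *\<^sub>R x) ` B = (\<lambda>x. inverse c *\<^sub>R x) -` B"
    using assms(2) by (auto intro!: image_eqI[where x="inverse c *\<^sub>R _"])
  have "continuous_on UNIV (\<lambda>x::'a. inverse c *\<^sub>R x)"
    unfolding continuous_on_def by (intro ballI tendsto_scaleR_lcs tendsto_const tendsto_ident_at)
  then have "closed ((\<lambda>x. c *\<^sub>R x) ` B)"
    unfolding im using assms(1) by (intro closed_vimage) (auto simp: barrel_def)
  moreover have "absorbs ((\<lambda>x. c *\<^sub>R x) ` B) {x}" for x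
  proof -
    obtain r where r: "r > 0" "\<forall>t::real. r \<le> \<bar>t\<bar> \<longrightarrow> {x} \<subseteq> (\<lambda>x. t *\<^sub>R x) ` B"
      using assms(1) unfolding barrel_def absorbent_def absorbs_def by meson
    have "{x} \<subseteq> (\<lambda>x. t *\<^sub>R x) ` (\<lambda>x. c *\<^sub>R x) ` B" if "r / c \<le> \<bar>t\<bar>" for t
    proof -
      have "r \<le> \<bar>t * c\<bar>" using that assms(2) by (simp add: abs_mult field_simps)
      then show ?thesis using r(2) by (auto simp: image_image)
    qed
    then show ?thesis
      unfolding absorbs_def using r(1) assms(2) by (intro exI[of _ "r / c"]) simp
  qed
  moreover have "balanced ((\<lambda>x. c *\<^sub>R x) ` B)"
    using assms(1) unfolding barrel_def balanced_def
    by (auto simp: mult.commute intro!: image_eqI[where x="_ *\<^sub>R _"])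
  ultimately show ?thesis
    using assms(1) by (auto simp: barrel_def absorbent_def convex_scaling)
qed

lemma barrel_strong_nhd:
  assumes "barrel B"
  obtains U where "openin strong_topology U" "0 \<in> U" "U \<subseteq> B"
proof
  let ?U = "{x. \<exists>A. barrel A \<and> (\<lambda>y. x + y) ` A \<subseteq> B}"
  have zero: "0 \<in> A" if A: "barrel A" for A :: "'a set"
  proof -
    obtain r :: real where "r > 0" "\<forall>t. r \<le> \<bar>t\<bar> \<longrightarrow> {0} \<subseteq> (\<lambda>x. t *\<^sub>R x) ` A"
      using A unfolding barrel_def absorbent_def absorbs_def by meson
    then have "{0} \<subseteq> (\<lambda>x. r *\<^sub>R x) ` A" "r \<noteq> 0" by auto
    then show ?thesis by auto
  qed
  show "openin strong_topology ?U"
    unfolding openin_strong_topology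
  proof
    fix x assume "x \<in> ?U"
    then obtain A where A: "barrel A" "(\<lambda>y. x + y) ` A \<subseteq> B" by blast
    let ?H = "(\<lambda>y. (1/2::real) *\<^sub>R y) ` A"
    have H: "barrel ?H" using A(1) by (rule barrel_scaleR) simp
    have "y + z \<in> A" if yz: "y \<in> ?H" "z \<in> ?H" for y z
    proof -
      obtain a b where "a \<in> A" "b \<in> A" "y = (1/2::real) *\<^sub>R a" "z = (1/2::real) *\<^sub>R b"
        using yz by auto
      moreover have "(1/2) *\<^sub>R a + (1/2) *\<^sub>R b \<in> A"
        using A(1) \<open>a \<in> A\<close> \<open>b \<in> A\<close> unfolding barrel_def by (intro convexD) auto
      ultimately show ?thesis by simp
    qed
    then have "(\<lambda>z. x + y + z) ` ?H \<subseteq> B" if y: "y \<in> ?H" for y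
      using A(2) y by (auto simp only: add.assoc image_subset_iff)
    with H have "(\<lambda>y. x + y) ` ?H \<subseteq> ?U" by blast
    with H show "\<exists>B. barrel B \<and> (\<lambda>y. x + y) ` B \<subseteq> ?U" by blast
  qed
  show "0 \<in> ?U" using assms by (auto intro!: exI[of _ B])
  show "?U \<subseteq> B"
  proof
    fix x assume "x \<in> ?U"
    then obtain A where "barrel A" "(\<lambda>y. x + y) ` A \<subseteq> B" by blast
    then show "x \<in> B" using zero[of A] imageI[of 0 A "\<lambda>y. x + y"] by auto
  qed
qed


subsection \<open>Cones\<close>

definition pointed :: "'a::real_vector set \<Rightarrow> bool"
  where "pointed K \<longleftrightarrow> K \<inter> uminus ` K = {0}"

definition dual_cone :: "'a::locally_convex_t2 set \<Rightarrow> 'a dual set"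
  where "dual_cone K = {f. \<forall>k\<in>K. 0 \<le> app f k}"

definition bPC_at_0 :: "'a::locally_convex_t2 set \<Rightarrow> bool"
  where "bPC_at_0 K \<longleftrightarrow>
    (\<exists>W V. openin weak_topology V \<and> 0 \<in> V \<and> V \<subseteq> W \<and> bounded_wrt strong_topology (K \<inter> W))"

definition directed_preorder :: "'i set \<Rightarrow> ('i \<Rightarrow> 'i \<Rightarrow> bool) \<Rightarrow> bool"
  where "directed_preorder \<Gamma> le \<longleftrightarrow> \<Gamma> \<noteq> {} \<and> (\<forall>i\<in>\<Gamma>. le i i) \<and>
    (\<forall>i\<in>\<Gamma>. \<forall>j\<in>\<Gamma>. \<forall>k\<in>\<Gamma>. le i j \<longrightarrow> le j k \<longrightarrow> le i k) \<and>
    (\<forall>i\<in>\<Gamma>. \<forall>j\<in>\<Gamma>. \<exists>k\<in>\<Gamma>. le i k \<and> le j k)"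

definition net_converges ::
    "'a topology \<Rightarrow> 'i set \<Rightarrow> ('i \<Rightarrow> 'i \<Rightarrow> bool) \<Rightarrow> ('i \<Rightarrow> 'a) \<Rightarrow> 'a \<Rightarrow> bool"
  where "net_converges T \<Gamma> le c l \<longleftrightarrow>
    (\<forall>U. openin T U \<and> l \<in> U \<longrightarrow> (\<exists>i\<in>\<Gamma>. \<forall>j\<in>\<Gamma>. le i j \<longrightarrow> c j \<in> U))"

text \<open>A definition cannot quantify over the type of the indices of a net. The nets below have
  their indices in the type \<open>'a set\<close>, which is no restriction by \<open>weak_s_ext_at_0_net\<close>.\<close>

definition weak_s_ext_at_0 :: "'a::locally_convex_t2 set \<Rightarrow> bool"
  where "weak_s_ext_at_0 K \<longleftrightarrow>
    (\<forall>(\<Gamma> :: 'a set set) le c c'. directed_preorder \<Gamma> le \<longrightarrow>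
      (\<forall>i\<in>\<Gamma>. c i \<in> K \<and> c' i \<in> K) \<longrightarrow>
      net_converges euclidean \<Gamma> le (\<lambda>i. (1/2::real) *\<^sub>R (c i + c' i)) 0 \<longrightarrow>
      net_converges weak_topology \<Gamma> le c 0)"

lemma weak_s_ext_at_0_net:
  fixes \<Gamma> :: "'i set" and c c' :: "'i \<Rightarrow> 'a::locally_convex_t2"
  assumes K: "weak_s_ext_at_0 K" and \<Gamma>: "directed_preorder \<Gamma> le"
    and c: "\<forall>i\<in>\<Gamma>. c i \<in> K \<and> c' i \<in> K"
    and lim: "net_converges euclidean \<Gamma> le (\<lambda>i. (1/2::real) *\<^sub>R (c i + c' i)) 0"
  shows "net_converges weak_topology \<Gamma> le c 0"
proof (rule ccontr)
  assume "\<not> ?thesis"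
  then obtain W where W: "openin weak_topology W" "0 \<in> W"
      "\<And>i. i \<in> \<Gamma> \<Longrightarrow> \<exists>j\<in>\<Gamma>. le i j \<and> c j \<notin> W"
    unfolding net_converges_def by auto
  define \<N> where "\<N> = {U :: 'a set. open U \<and> 0 \<in> U}"
  have "\<exists>j\<in>\<Gamma>. (1/2::real) *\<^sub>R (c j + c' j) \<in> U \<and> c j \<notin> W" if U: "U \<in> \<N>" for U
  proof -
    obtain i where i: "i \<in> \<Gamma>" "\<And>j. j \<in> \<Gamma> \<Longrightarrow> le i j \<Longrightarrow> (1/2::real) *\<^sub>R (c j + c' j) \<in> U"
      using lim[unfolded net_converges_def, rule_format, of U] U by (auto simp: \<N>_def)
    then show ?thesis using W(3)[OF i(1)] by blast
  qed
  then have "\<exists>j. \<forall>U\<in>\<N>. j U \<in> \<Gamma> \<and> (1/2::real) *\<^sub>R (c (j U) + c' (j U)) \<in> U \<and> c (j U) \<notin> W"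
    by (intro bchoice) blast
  then obtain j where j: "\<And>U. U \<in> \<N> \<Longrightarrow> j U \<in> \<Gamma>"
      "\<And>U. U \<in> \<N> \<Longrightarrow> (1/2::real) *\<^sub>R (c (j U) + c' (j U)) \<in> U" "\<And>U. U \<in> \<N> \<Longrightarrow> c (j U) \<notin> W"
    by blast
  have UNIV: "UNIV \<in> \<N>" by (simp add: \<N>_def)
  have dir: "directed_preorder \<N> (\<lambda>U V. V \<subseteq> U)"
    unfolding directed_preorder_def
  proof (intro conjI ballI impI)
    fix U V assume "U \<in> \<N>" "V \<in> \<N>"
    then show "\<exists>X\<in>\<N>. X \<subseteq> U \<and> X \<subseteq> V"
      by (intro bexI[of _ "U \<inter> V"]) (auto simp: \<N>_def)
  qed (use UNIV in auto)
  have "net_converges euclidean \<N> (\<lambda>U V. V \<subseteq> U) (\<lambda>U. (1/2::real) *\<^sub>R (c (j U) + c' (j U))) 0"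
    unfolding net_converges_def
  proof (intro allI impI)
    fix U :: "'a set" assume "openin euclidean U \<and> 0 \<in> U"
    then have "U \<in> \<N>" by (simp add: \<N>_def)
    then show "\<exists>i\<in>\<N>. \<forall>V\<in>\<N>. V \<subseteq> i \<longrightarrow> (1/2::real) *\<^sub>R (c (j V) + c' (j V)) \<in> U"
      using j(2) by (intro bexI[of _ U]) auto
  qed
  then have "net_converges weak_topology \<N> (\<lambda>U V. V \<subseteq> U) (\<lambda>U. c (j U)) 0"
    using K[unfolded weak_s_ext_at_0_def, rule_format, OF dir,
        of "\<lambda>U. c (j U)" "\<lambda>U. c' (j U)"] c j(1) by blast
  then obtain U where "U \<in> \<N>" "\<And>V. V \<in> \<N> \<Longrightarrow> V \<subseteq> U \<Longrightarrow> c (j V) \<in> W"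
    using W(1,2) unfolding net_converges_def by metis
  with j(3) show False by blast
qed

end

theory Submission
  imports Defs
begin

text \<open>The weak neighbourhood in the definition of \<^const>\<open>bPC_at_0\<close> involves only finitely many functionals
  \<open>f\<^sub>1, \<dots>, f\<^sub>n\<close>, and on \<open>K\<close> smallness of \<open>p = \<bar>f\<^sub>1\<bar> + \<dots> + \<bar>f\<^sub>n\<bar>\<close> forces smallness in the strong topology.
  Consider the closure of the image of \<open>K\<close> in \<open>n\<close>-dimensional space. If it is pointed, some linear
  combination of the \<open>f\<^sub>i\<close> dominates a multiple of \<open>p\<close> on \<open>K\<close> and defines a bounded slice. Otherwise it
  contains some \<open>L \<noteq> 0\<close> together with \<open>- L\<close>, the limits of the images of sequences \<open>a\<close> and \<open>b\<close> in \<open>K\<close>.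
  Then \<open>a\<^sub>m + b\<^sub>n\<close> is strongly small for large \<open>m\<close>, \<open>n\<close>, which contradicts strong extremality of \<open>0\<close>; and
  since \<open>a\<^sub>m - a\<^sub>n = (a\<^sub>m + b\<^sub>k) - (a\<^sub>n + b\<^sub>k)\<close>, the sequence \<open>a\<close> is strongly Cauchy, so it has a limit
  \<open>\<phi> \<noteq> 0\<close> in the bidual, and \<open>b\<close> tends to \<open>- \<phi>\<close>. Conversely, a bounded slice given by \<open>f\<close> makes every
  functional \<open>g\<close> bounded by a multiple of \<open>f\<close> on \<open>K\<close>, hence a difference of elements of the dual cone.\<close>

subsection \<open>Cones under finitely many functionals\<close>

text \<open>Bolzano-Weierstrass one coordinate at a time: each inserted index refines the
  subsequence found so far, and convergent coordinates stay convergent along a refinement.\<close>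

lemma finite_bounded_convergent_subseq:
  fixes x :: "'i \<Rightarrow> nat \<Rightarrow> real"
  assumes "finite I" "\<And>i. i \<in> I \<Longrightarrow> bounded (range (x i))"
  shows "\<exists>r::nat \<Rightarrow> nat. strict_mono r \<and> (\<forall>i\<in>I. convergent (\<lambda>n. x i (r n)))"
  using assms
proof (induction I)
  case empty
  show ?case by (intro exI[of _ id]) (simp add: strict_mono_def)
next
  case (insert i I)
  then obtain r :: "nat \<Rightarrow> nat" where r: "strict_mono r" "\<forall>j\<in>I. convergent (\<lambda>n. x j (r n))"
    by auto
  have "bounded (range (\<lambda>n. x i (r n)))"
    using insert.prems[of i] by (rule bounded_subset) auto
  then obtain l s where s: "strict_mono (s::nat \<Rightarrow> nat)" "((\<lambda>n. x i (r n)) \<circ> s) \<longlonglongrightarrow> l"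
    using bounded_imp_convergent_subsequence by blast
  have "convergent (\<lambda>n. x j ((r \<circ> s) n))" if "j \<in> I" for j
    using convergent_subseq_convergent[OF bspec[OF r(2) that] s(1)] by (simp add: o_def)
  moreover have "convergent (\<lambda>n. x i ((r \<circ> s) n))"
    using s(2) by (auto simp: o_def convergent_def)
  ultimately show ?case
    using strict_mono_o[OF r(1) s(1)] by blast
qed

text \<open>An almost minimiser \<open>z\<close> of the quadratic form replaces the nearest point of \<open>C\<close> to the origin.\<close>

lemma convex_inner_lower_bound:
  fixes f :: "'i \<Rightarrow> 'a::real_vector \<Rightarrow> real"
  assumes C: "convex C" "C \<noteq> {}" and lin: "\<And>i. linear (f i)"
    and m: "m > 0" "\<And>z. z \<in> C \<Longrightarrow> m \<le> (\<Sum>i\<in>I. (f i z)\<^sup>2)"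
    and bdd: "\<And>y z. y \<in> C \<Longrightarrow> z \<in> C \<Longrightarrow> (\<Sum>i\<in>I. (f i y - f i z)\<^sup>2) \<le> M"
  shows "\<exists>z. \<forall>y\<in>C. m / 2 \<le> (\<Sum>i\<in>I. f i z * f i y)"
proof -
  define q where "q z = (\<Sum>i\<in>I. (f i z)\<^sup>2)" for z
  define \<mu> where "\<mu> = Inf (q ` C)"
  have bb: "bdd_below (q ` C)" using m(2) by (auto simp: q_def intro!: bdd_belowI[of _ m])
  have \<mu>: "m \<le> \<mu>" unfolding \<mu>_def using C(2) m(2) by (intro cINF_greatest) (auto simp: q_def)
  have \<mu>_le: "\<mu> \<le> q y" if "y \<in> C" for y unfolding \<mu>_def using bb that by (rule cINF_lower)
  obtain y0 where "y0 \<in> C" using C(2) by blast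
  then have M: "M \<ge> 0" using bdd[of y0 y0] by simp
  \<comment> \<open>Step length from \<open>z\<close> towards \<open>y\<close>, so short that the
    remainder \<open>t\<^sup>2 * M\<close> costs at most \<open>t * m / 2\<close>. The
    \<open>1\<close> added to \<open>M\<close> keeps the divisor positive when
    \<open>M = 0\<close>.\<close>
  define t where "t = min 1 (m / (2 * (M + 1)))"
  have t: "0 < t" "t \<le> 1" "t * M \<le> m / 2"
  proof -
    have "0 < m / (2 * (M + 1))" using m(1) M by (intro divide_pos_pos) auto
    then show "0 < t" "t \<le> 1" by (auto simp: t_def)
    have "t * M \<le> m / (2 * (M + 1)) * (M + 1)"
      using m(1) M by (intro mult_mono) (auto simp: t_def)
    also have "\<dots> = m / 2" using M by (subst times_divide_eq_left) (simp add: divide_simps)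
    finally show "t * M \<le> m / 2" .
  qed
  have "\<exists>z\<in>C. q z < \<mu> + t * m / 2"
    using cInf_lessD[of "q ` C" "\<mu> + t * m / 2"] C(2) t(1) m(1) by (auto simp: \<mu>_def)
  then obtain z where z: "z \<in> C" "q z < \<mu> + t * m / 2" by blast
  have "m / 2 \<le> (\<Sum>i\<in>I. f i z * f i y)" if y: "y \<in> C" for y
  proof -
    \<comment> \<open>First variation: a small move from \<open>z\<close> towards \<open>y\<close>
      cannot take \<open>q\<close> below its infimum, so the inner product is at least
      \<open>q z - m / 2\<close>.\<close>
    have "(1 - t) *\<^sub>R z + t *\<^sub>R y \<in> C" using C(1) z(1) y t by (intro convexD) auto
    then have "\<mu> \<le> q ((1 - t) *\<^sub>R z + t *\<^sub>R y)" by (rule \<mu>_le)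
    also have "\<dots> = (\<Sum>i\<in>I. (f i z)\<^sup>2 + 2 * t * (f i z * f i y - (f i z)\<^sup>2) + t\<^sup>2 * (f i y - f i z)\<^sup>2)"
      unfolding q_def
      by (intro sum.cong) (simp_all only: linear_add[OF lin] linear_scale[OF lin],
          simp add: power2_eq_square algebra_simps)
    also have "\<dots> = q z + 2 * t * ((\<Sum>i\<in>I. f i z * f i y) - q z) + t\<^sup>2 * (\<Sum>i\<in>I. (f i y - f i z)\<^sup>2)"
      by (simp add: q_def sum.distrib sum_subtractf sum_distrib_left[symmetric])
    also have "t\<^sup>2 * (\<Sum>i\<in>I. (f i y - f i z)\<^sup>2) \<le> t * (t * M)"
      using bdd[OF y z(1)] t(1) by (simp add: power2_eq_square mult.assoc)
    also have "t * (t * M) \<le> t * (m / 2)" using t by (intro mult_left_mono) auto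
    finally have "0 \<le> t * (m + 2 * ((\<Sum>i\<in>I. f i z * f i y) - q z))"
      using z(2) by (simp add: algebra_simps)
    then have "0 \<le> m + 2 * ((\<Sum>i\<in>I. f i z * f i y) - q z)"
      using t(1) by (simp add: zero_le_mult_iff)
    then show ?thesis using \<mu> \<mu>_le[OF z(1)] by simp
  qed
  then show ?thesis by blast
qed

text \<open>Separation in coordinate space, carried out on a convex set \<open>C\<close> in the
  domain. If the sum of squares stays away from 0 on \<open>C\<close>, a near-minimiser supplies
  \<open>c\<close>; otherwise ever smaller points of \<open>C\<close> split into summands whose
  coordinates tend to \<open>L\<close> and \<open>- L\<close> along a subsequence.\<close>

lemma finite_functionals_dichotomy:
  fixes f :: "'i \<Rightarrow> 'a::real_vector \<Rightarrow> real"
  assumes I: "finite I" and lin: "\<And>i. linear (f i)" and K: "convex_cone K"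
  obtains (positive) c \<delta> where "\<delta> > 0"
      "\<And>k. k \<in> K \<Longrightarrow> \<delta> * (\<Sum>i\<in>I. \<bar>f i k\<bar>) \<le> (\<Sum>i\<in>I. c i * f i k)"
  | (opposite) a b L i where "\<And>n::nat. a n \<in> K" "\<And>n. b n \<in> K"
      "\<And>j. j \<in> I \<Longrightarrow> (\<lambda>n. f j (a n)) \<longlonglongrightarrow> L j" "\<And>j. j \<in> I \<Longrightarrow> (\<lambda>n. f j (b n)) \<longlonglongrightarrow> - L j"
      "i \<in> I" "L i \<noteq> 0"
proof -
  define s where "s x = (\<Sum>i\<in>I. \<bar>f i x\<bar>)" for x
  define ok where "ok z a b \<longleftrightarrow> (\<forall>i\<in>I. a i \<in> K \<and> b i \<in> K \<and> z = a i + b i \<and> s (a i) \<le> 1)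
    \<and> s z \<le> 1 \<and> 1 \<le> (\<Sum>i\<in>I. f i (a i) - f i (b i))" for z a b
  \<comment> \<open>\<open>C\<close> contains the convex hull of \<open>{k \<in> K. s k = 1}\<close>. The decompositions \<open>z = a i + b i\<close>, one for each
    functional, separate the summands of a convex combination by the sign of \<open>f i\<close>; they survive
    convex combinations and show that a small \<open>z \<in> C\<close> is a sum of two large elements of \<open>K\<close>.\<close>
  define C where "C = {z. \<exists>a b. ok z a b}"
  have f_le_s: "\<bar>f i x\<bar> \<le> s x" if "i \<in> I" for i x
    unfolding s_def using I that by (intro member_le_sum) auto
  have s_conv: "s (u *\<^sub>R x + v *\<^sub>R y) \<le> 1"
    if "s x \<le> 1" "s y \<le> 1" "u \<ge> 0" "v \<ge> 0" "u + v = 1" for u v x y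
  proof -
    have "s (u *\<^sub>R x + v *\<^sub>R y) \<le> (\<Sum>i\<in>I. u * \<bar>f i x\<bar> + v * \<bar>f i y\<bar>)"
      unfolding s_def
    proof (rule sum_mono)
      fix i
      show "\<bar>f i (u *\<^sub>R x + v *\<^sub>R y)\<bar> \<le> u * \<bar>f i x\<bar> + v * \<bar>f i y\<bar>"
        using abs_triangle_ineq[of "u * f i x" "v * f i y"] that
        by (simp add: linear_add[OF lin] linear_scale[OF lin] abs_mult)
    qed
    also have "\<dots> = u * s x + v * s y" by (simp add: s_def sum.distrib sum_distrib_left)
    also have "\<dots> \<le> u * 1 + v * 1" using that by (intro add_mono mult_left_mono) auto
    finally show ?thesis using that by simp
  qed
  have convC: "convex C"
    unfolding convex_def
  proof (intro ballI allI impI)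
    fix x y and u v :: real
    assume x: "x \<in> C" and y: "y \<in> C" and uv: "0 \<le> u" "0 \<le> v" "u + v = 1"
    obtain a b where ab: "ok x a b" using x by (auto simp: C_def)
    obtain a' b' where ab': "ok y a' b'" using y by (auto simp: C_def)
    let ?a = "\<lambda>i. u *\<^sub>R a i + v *\<^sub>R a' i" and ?b = "\<lambda>i. u *\<^sub>R b i + v *\<^sub>R b' i"
    have "ok (u *\<^sub>R x + v *\<^sub>R y) ?a ?b"
      unfolding ok_def
    proof (intro conjI ballI)
      fix i assume i: "i \<in> I"
      show "?a i \<in> K" "?b i \<in> K"
        using K i ab ab' uv by (auto simp: ok_def convex_cone_iff)
      have "x = a i + b i" "y = a' i + b' i" using i ab ab' by (auto simp: ok_def)
      then show "u *\<^sub>R x + v *\<^sub>R y = ?a i + ?b i" by (simp add: algebra_simps)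
      show "s (?a i) \<le> 1" using i ab ab' uv by (intro s_conv) (auto simp: ok_def)
    next
      show "s (u *\<^sub>R x + v *\<^sub>R y) \<le> 1" using ab ab' uv by (intro s_conv) (auto simp: ok_def)
      have "1 = u * 1 + v * 1" using uv by simp
      also have "\<dots> \<le> u * (\<Sum>i\<in>I. f i (a i) - f i (b i)) + v * (\<Sum>i\<in>I. f i (a' i) - f i (b' i))"
        using ab ab' uv by (intro add_mono mult_left_mono) (auto simp: ok_def)
      also have "\<dots> = (\<Sum>i\<in>I. f i (?a i) - f i (?b i))"
        by (simp add: sum_distrib_left sum.distrib[symmetric] linear_add[OF lin]
            linear_scale[OF lin] algebra_simps)
      finally show "1 \<le> (\<Sum>i\<in>I. f i (?a i) - f i (?b i))" .
    qed
    then show "u *\<^sub>R x + v *\<^sub>R y \<in> C" by (auto simp: C_def)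
  qed
  have s0: "s 0 = 0" by (simp add: s_def linear_0[OF lin])
  have DC: "k \<in> C" if k: "k \<in> K" "s k = 1" for k
  proof -
    \<comment> \<open>All of \<open>k\<close> goes to the first or the second summand according to
      the sign of \<open>f i k\<close>, so the differences add up to \<open>s k = 1\<close>.\<close>
    have "ok k (\<lambda>i. if f i k \<ge> 0 then k else 0) (\<lambda>i. if f i k \<ge> 0 then 0 else k)"
      unfolding ok_def
    proof (intro conjI ballI)
      have "1 = (\<Sum>i\<in>I. \<bar>f i k\<bar>)" using k(2) by (simp add: s_def)
      also have "\<dots> = (\<Sum>i\<in>I. f i (if f i k \<ge> 0 then k else 0) - f i (if f i k \<ge> 0 then 0 else k))"
        by (intro sum.cong) (auto simp: linear_0[OF lin])
      finally show "1 \<le> \<dots>" by simp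
    qed (use k s0 K in \<open>auto simp: convex_cone_iff\<close>)
    then show ?thesis by (auto simp: C_def)
  qed
  show thesis
  proof (cases "\<exists>m>0. \<forall>z\<in>C. m \<le> (\<Sum>i\<in>I. (f i z)\<^sup>2)")
    case True
    then obtain m where m: "m > 0" "\<And>z. z \<in> C \<Longrightarrow> m \<le> (\<Sum>i\<in>I. (f i z)\<^sup>2)" by blast
    have "\<exists>z. \<forall>y\<in>C. m / 2 \<le> (\<Sum>i\<in>I. f i z * f i y)"
    proof (cases "C = {}")
      case False
      have "(\<Sum>i\<in>I. (f i y - f i z)\<^sup>2) \<le> (\<Sum>i\<in>I. 2\<^sup>2)" if "y \<in> C" "z \<in> C" for y z
      proof (rule sum_mono)
        fix i assume "i \<in> I"
        then have "\<bar>f i y\<bar> \<le> 1" "\<bar>f i z\<bar> \<le> 1"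
          using that f_le_s order_trans by (fastforce simp: C_def ok_def)+
        then have "\<bar>f i y - f i z\<bar> \<le> 2" by linarith
        then show "(f i y - f i z)\<^sup>2 \<le> 2\<^sup>2" using abs_le_square_iff[of "f i y - f i z" 2] by simp
      qed
      then show ?thesis using convex_inner_lower_bound[OF convC False lin m] by blast
    qed simp
    then obtain z where z: "\<And>y. y \<in> C \<Longrightarrow> m / 2 \<le> (\<Sum>i\<in>I. f i z * f i y)" by blast
    \<comment> \<open>The coefficients are the coordinates \<open>f i z\<close>. Rescaling to
      \<open>s k = 1\<close> reduces the bound to \<open>C\<close>; where \<open>s k = 0\<close>,
      every coordinate vanishes.\<close>
    show thesis
    proof (rule positive)
      show "m / 2 > 0" using m by simp
      fix k assume k: "k \<in> K"
      have "s k \<ge> 0" by (auto simp: s_def intro: sum_nonneg)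
      then consider "s k = 0" | "s k > 0" by linarith
      then have "m / 2 * s k \<le> (\<Sum>i\<in>I. f i z * f i k)"
      proof cases
        case 1
        then have "\<bar>f i k\<bar> = 0" if "i \<in> I" for i using I that f_le_s[OF that, of k] by simp
        with 1 show ?thesis by simp
      next
        case 2
        let ?y = "inverse (s k) *\<^sub>R k"
        have "?y \<in> K" using K k 2 by (auto simp: convex_cone_iff)
        moreover have "s ?y = 1"
          using 2 unfolding s_def
          by (simp add: linear_scale[OF lin] abs_mult sum_distrib_left[symmetric])
        ultimately have "m / 2 \<le> (\<Sum>i\<in>I. f i z * f i ?y)" by (intro z DC)
        also have "\<dots> = inverse (s k) * (\<Sum>i\<in>I. f i z * f i k)"
          by (simp add: linear_scale[OF lin] sum_distrib_left mult.left_commute)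
        finally show ?thesis using 2 by (simp add: field_simps)
      qed
      then show "m / 2 * (\<Sum>i\<in>I. \<bar>f i k\<bar>) \<le> (\<Sum>i\<in>I. f i z * f i k)" by (simp add: s_def)
    qed
  next
    case False
    \<comment> \<open>The \<open>+ 1\<close> makes \<open>card I / N\<close> strictly less than 1,
      so some difference \<open>f i (a i) - f i (b i)\<close> must reach
      \<open>1 / N\<close>.\<close>
    define N where "N = real (card I) + 1"
    have N: "N > 0" by (simp add: N_def)
    have "\<exists>x y. x \<in> K \<and> y \<in> K \<and> s x \<le> 1 \<and> 1 / (4 * N) \<le> s x \<and> (\<forall>i\<in>I. \<bar>f i (x + y)\<bar> < \<eta>)"
      if "\<eta> > 0" for \<eta> :: real
    proof -
      \<comment> \<open>The cap \<open>1 / (2 * N)\<close> on \<open>\<bar>f i z\<bar>\<close>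
        leaves \<open>2 * f i (a i)\<close> at least \<open>1 / (2 * N)\<close>: the summand
        \<open>a i\<close> stays large while \<open>z\<close> shrinks.\<close>
      define \<eta>' where "\<eta>' = min \<eta> (1 / (2 * N))"
      have \<eta>': "\<eta>' > 0" using that N by (simp add: \<eta>'_def)
      obtain z where z: "z \<in> C" "(\<Sum>i\<in>I. (f i z)\<^sup>2) < \<eta>'\<^sup>2"
        using False \<eta>' by (meson not_le zero_less_power)
      have small: "\<bar>f i z\<bar> < \<eta>'" if "i \<in> I" for i
      proof -
        have "(f i z)\<^sup>2 \<le> (\<Sum>i\<in>I. (f i z)\<^sup>2)" using I that by (intro member_le_sum) auto
        then have "\<bar>f i z\<bar>\<^sup>2 < \<eta>'\<^sup>2" using z(2) by simp
        then show ?thesis using \<eta>' by (intro power2_less_imp_less[of "\<bar>f i z\<bar>"]) auto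
      qed
      obtain a b where ab: "ok z a b" using z(1) by (auto simp: C_def)
      have "\<exists>i\<in>I. 1 / N \<le> f i (a i) - f i (b i)"
      proof (rule ccontr)
        assume "\<not> ?thesis"
        then have "(\<Sum>i\<in>I. f i (a i) - f i (b i)) \<le> of_nat (card I) * (1 / N)"
          by (intro sum_bounded_above) (auto simp: not_le intro: less_imp_le)
        also have "\<dots> < 1" by (simp add: N_def)
        finally show False using ab by (simp add: ok_def)
      qed
      then obtain i where i: "i \<in> I" "1 / N \<le> f i (a i) - f i (b i)" by blast
      have zi: "z = a i + b i" using ab i(1) by (simp add: ok_def)
      then have "f i z = f i (a i) + f i (b i)" by (simp add: linear_add[OF lin])
      moreover have "\<bar>f i z\<bar> < 1 / (2 * N)" using small[OF i(1)] by (simp add: \<eta>'_def)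
      ultimately have "1 / N - 1 / (2 * N) \<le> 2 * f i (a i)" using i(2) by linarith
      then have "1 / (4 * N) \<le> f i (a i)" using N by (simp add: field_simps)
      then have "1 / (4 * N) \<le> s (a i)" using f_le_s[OF i(1), of "a i"] by linarith
      moreover have "\<forall>j\<in>I. \<bar>f j (a i + b i)\<bar> < \<eta>" using small zi by (auto simp: \<eta>'_def)
      ultimately show ?thesis
        using ab i(1) by (intro exI[of _ "a i"] exI[of _ "b i"]) (auto simp: ok_def)
    qed
    then have "\<forall>n. \<exists>x y. x \<in> K \<and> y \<in> K \<and> s x \<le> 1 \<and> 1 / (4 * N) \<le> s x \<and>
        (\<forall>i\<in>I. \<bar>f i (x + y)\<bar> < 1 / real (Suc n))" by simp
    then obtain x y where xy: "\<And>n. x n \<in> K" "\<And>n. y n \<in> K" "\<And>n. s (x n) \<le> 1"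
        "\<And>n. 1 / (4 * N) \<le> s (x n)" "\<And>n i. i \<in> I \<Longrightarrow> \<bar>f i (x n + y n)\<bar> < 1 / real (Suc n)"
      by metis
    have "bounded (range (\<lambda>n. f i (x n)))" if "i \<in> I" for i
      using f_le_s[OF that] xy(3) unfolding bounded_iff real_norm_def
      by (intro exI[of _ 1]) (auto intro: order_trans)
    then obtain r :: "nat \<Rightarrow> nat" where r: "strict_mono r" "\<forall>i\<in>I. convergent (\<lambda>n. f i (x (r n)))"
      using finite_bounded_convergent_subseq[OF I, of "\<lambda>i n. f i (x n)"] by blast
    define L where "L i = lim (\<lambda>n. f i (x (r n)))" for i
    have L: "(\<lambda>n. f i (x (r n))) \<longlonglongrightarrow> L i" if "i \<in> I" for i
      using r(2) that by (simp add: L_def convergent_LIMSEQ_iff)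
    have sum0: "(\<lambda>n. f i (x (r n) + y (r n))) \<longlonglongrightarrow> 0" if "i \<in> I" for i
    proof -
      have "(\<lambda>n. f i (x n + y n)) \<longlonglongrightarrow> 0"
        using xy(5)[OF that] less_imp_le
        by (intro Lim_null_comparison[OF _ LIMSEQ_inverse_real_of_nat] always_eventually)
           (auto simp: inverse_eq_divide)
      then show ?thesis using LIMSEQ_subseq_LIMSEQ[OF _ r(1)] by (fastforce simp: o_def)
    qed
    \<comment> \<open>The lower bound on \<open>s (x n)\<close> passes to the limit, so some
      \<open>L i\<close> is nonzero.\<close>
    have "(\<lambda>n. s (x (r n))) \<longlonglongrightarrow> (\<Sum>i\<in>I. \<bar>L i\<bar>)"
      unfolding s_def using L by (intro tendsto_sum tendsto_rabs)
    then have "1 / (4 * N) \<le> (\<Sum>i\<in>I. \<bar>L i\<bar>)"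
      by (rule LIMSEQ_le_const) (use xy(4) in auto)
    then have "(\<Sum>i\<in>I. \<bar>L i\<bar>) \<noteq> 0" using N by (auto simp: field_simps)
    then obtain i where "i \<in> I" "L i \<noteq> 0" by (metis abs_zero sum.neutral)
    moreover have "(\<lambda>n. f i (y (r n))) \<longlonglongrightarrow> - L i" if "i \<in> I" for i
      using tendsto_diff[OF sum0[OF that] L[OF that]] by (simp add: linear_add[OF lin])
    ultimately show thesis
      using opposite[of "\<lambda>n. x (r n)" "\<lambda>n. y (r n)" L i] xy(1,2) L by blast
  qed
qed


subsection \<open>Barrels and strongly bounded sets\<close>

text \<open>Separate continuity of convex combinations suffices: one argument is moved to the
  closure, then the other.\<close>

lemma convex_closure_lcs:
  fixes S :: "'a::locally_convex_t2 set"
  assumes "convex S"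
  shows "convex (closure S)"
  unfolding convex_def
proof (intro ballI allI impI)
  fix x y :: 'a and u v :: real
  assume x: "x \<in> closure S" and y: "y \<in> closure S" and uv: "0 \<le> u" "0 \<le> v" "u + v = 1"
  have cont1: "continuous_on T (\<lambda>a. u *\<^sub>R a + v *\<^sub>R b)" for T and b :: 'a
    unfolding continuous_on_def
    by (intro ballI tendsto_add tendsto_scaleR_lcs tendsto_const tendsto_ident_at)
  have cont2: "continuous_on T (\<lambda>b. u *\<^sub>R a + v *\<^sub>R b)" for T and a :: 'a
    unfolding continuous_on_def
    by (intro ballI tendsto_add tendsto_scaleR_lcs tendsto_const tendsto_ident_at)
  have "u *\<^sub>R a + v *\<^sub>R b \<in> closure S" if "a \<in> S" "b \<in> S" for a b
    using convexD[OF assms that uv] closure_subset by blast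
  then have 1: "(\<lambda>a. u *\<^sub>R a + v *\<^sub>R b) ` closure S \<subseteq> closure S" if "b \<in> S" for b
    using that by (intro image_closure_subset[OF cont1]) auto
  then have "(\<lambda>b. u *\<^sub>R x + v *\<^sub>R b) ` closure S \<subseteq> closure S"
    using x by (intro image_closure_subset[OF cont2]) auto
  then show "u *\<^sub>R x + v *\<^sub>R y \<in> closure S" using y by blast
qed

lemma barrel_closure:
  fixes V :: "'a::locally_convex_t2 set"
  assumes "open V" "0 \<in> V" "convex V" "\<And>x. x \<in> V \<Longrightarrow> - x \<in> V"
  shows "barrel (closure V)"
  unfolding barrel_def
proof (intro conjI)
  show "convex (closure V)" using assms(3) by (rule convex_closure_lcs)
  show "balanced (closure V)"
    unfolding balanced_def
  proof (intro ballI allI impI)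
    fix x :: 'a and t :: real
    assume x: "x \<in> closure V" and t: "\<bar>t\<bar> \<le> 1"
    have "continuous_on (closure V) (\<lambda>x. t *\<^sub>R x)"
      unfolding continuous_on_def by (intro ballI tendsto_scaleR_lcs tendsto_const tendsto_ident_at)
    moreover have "t *\<^sub>R y \<in> V" if y: "y \<in> V" for y
    proof -
      \<comment> \<open>For \<open>\<bar>t\<bar> \<le> 1\<close>, symmetry and convexity give
        balancedness: \<open>t *\<^sub>R y\<close> is a convex combination of \<open>y\<close> and
        \<open>- y\<close>.\<close>
      have "((1 + t) / 2) *\<^sub>R y + ((1 - t) / 2) *\<^sub>R (- y) \<in> V"
        using assms(3) y assms(4)[OF y] t by (intro convexD) (auto simp: field_simps abs_le_iff)
      moreover have "((1 + t) / 2) *\<^sub>R y + ((1 - t) / 2) *\<^sub>R (- y) = t *\<^sub>R y"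
        by (simp add: scaleR_diff_left[symmetric] diff_divide_distrib[symmetric])
      ultimately show ?thesis by simp
    qed
    then have "(\<lambda>x. t *\<^sub>R x) ` V \<subseteq> closure V" using closure_subset by blast
    ultimately have "(\<lambda>x. t *\<^sub>R x) ` closure V \<subseteq> closure V"
      by (intro image_closure_subset) auto
    then show "t *\<^sub>R x \<in> closure V" using x by blast
  qed
  show "absorbent (closure V)"
    unfolding absorbent_def
  proof
    fix x
    have "absorbs V {x}" using open_absorbent[OF assms(1,2)] by (simp add: absorbent_def)
    then show "absorbs (closure V) {x}"
      unfolding absorbs_def using closure_subset[of V] by (meson image_mono order_trans)
  qed
qed simp

text \<open>The closure of the symmetric set \<open>W\<close> lies in \<open>W + W\<close>, and the
  halving built into \<open>V\<close> puts that sum inside \<open>U\<close>. Hence the strong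
  topology refines the given one.\<close>

lemma open_contains_barrel:
  fixes U :: "'a::locally_convex_t2 set"
  assumes "open U" "0 \<in> U"
  obtains B where "barrel B" "B \<subseteq> U"
proof -
  have cont_scale: "continuous_on UNIV (\<lambda>x::'a. 2 *\<^sub>R x)"
    unfolding continuous_on_def by (intro ballI tendsto_scaleR_lcs tendsto_const tendsto_ident_at)
  have "open ((\<lambda>x. 2 *\<^sub>R x) -` U)" using assms(1) cont_scale by (rule open_vimage)
  then obtain V where V: "open V" "0 \<in> V" "V \<subseteq> (\<lambda>x. 2 *\<^sub>R x) -` U" "convex V"
    using locally_convex[of "(\<lambda>x. 2 *\<^sub>R x) -` U"] assms(2) by auto
  define W where "W = V \<inter> uminus -` V"
  have W: "open W" "0 \<in> W" "convex W"
  proof -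
    show "open W" unfolding W_def using V(1)
      by (intro open_Int open_vimage continuous_intros) auto
    show "0 \<in> W" using V(2) by (simp add: W_def)
    have "convex (uminus -` V)"
      unfolding convex_def
    proof (intro ballI allI impI)
      fix x y and u v :: real
      assume "x \<in> uminus -` V" "y \<in> uminus -` V" "0 \<le> u" "0 \<le> v" "u + v = 1"
      then show "u *\<^sub>R x + v *\<^sub>R y \<in> uminus -` V"
        using convexD[OF V(4), of "- x" "- y" u v] by simp
    qed
    then show "convex W" using V(4) by (simp add: W_def convex_Int)
  qed
  have sym: "- x \<in> W" if "x \<in> W" for x using that by (simp add: W_def)
  have "closure W \<subseteq> U"
  proof
    fix x assume x: "x \<in> closure W"
    have "open ((\<lambda>y. y - x) -` W)" using W(1) by (intro open_vimage continuous_intros) auto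
    moreover have "x \<in> (\<lambda>y. y - x) -` W" using W(2) by simp
    ultimately have "W \<inter> (\<lambda>y. y - x) -` W \<noteq> {}"
      using x unfolding closure_iff_nhds_not_empty by blast
    then obtain y where y: "y \<in> W" "x - y \<in> W" using sym by fastforce
    then have "(1/2::real) *\<^sub>R y + (1/2) *\<^sub>R (x - y) \<in> V"
      using V(4) by (intro convexD) (auto simp: W_def)
    then show "x \<in> U" using V(3) by (auto simp: scaleR_add_right[symmetric])
  qed
  with barrel_closure[OF W sym] show thesis by (rule that)
qed

section \<open>Polars as barrels, and absorption of strongly bounded sets\<close>

text \<open>An intersection of closed strips is closed, convex and balanced; pointwise boundedness
  of \<open>S\<close> is what makes it absorbent.\<close>

lemma barrel_polar:
  fixes S :: "'a::locally_convex_t2 dual set"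
  assumes bdd: "\<And>x. \<exists>M. \<forall>g\<in>S. \<bar>app g x\<bar> \<le> M" and e: "e > 0"
  shows "barrel {x. \<forall>g\<in>S. \<bar>app g x\<bar> \<le> e}" (is "barrel ?B")
  unfolding barrel_def
proof (intro conjI)
  have eq: "?B = (\<Inter>g\<in>S. app g -` {-e..e})" by (auto simp: abs_le_iff)
  show "closed ?B"
    unfolding eq using continuous_on_app by (intro closed_INT ballI closed_vimage) auto
  show "convex ?B"
    unfolding eq by (intro convex_INT convex_linear_vimage linear_app) simp
  show "balanced ?B"
    unfolding balanced_def
    by (auto simp: linear_scale[OF linear_app] abs_mult) (meson abs_ge_zero mult_left_le_one_le order_trans)
  show "absorbent ?B"
    unfolding absorbent_def
  proof
    fix x
    obtain M where M: "\<forall>g\<in>S. \<bar>app g x\<bar> \<le> M" using bdd by blast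
    define r where "r = (\<bar>M\<bar> + 1) / e"
    have r: "r > 0" using e by (simp add: r_def)
    have "{x} \<subseteq> (\<lambda>x. t *\<^sub>R x) ` ?B" if t: "r \<le> \<bar>t\<bar>" for t
    proof -
      have t0: "t \<noteq> 0" using r t by auto
      have "\<bar>app g (inverse t *\<^sub>R x)\<bar> \<le> e" if "g \<in> S" for g
      proof -
        have "\<bar>app g x\<bar> \<le> \<bar>M\<bar> + 1" using M that by fastforce
        also have "\<dots> \<le> e * \<bar>t\<bar>" using t e by (simp add: r_def field_simps)
        finally show ?thesis
          using t0 by (simp add: linear_scale[OF linear_app] abs_mult field_simps)
      qed
      then show ?thesis using t0 by (auto intro!: image_eqI[where x="inverse t *\<^sub>R x"])
    qed
    then show "absorbs ?B {x}" unfolding absorbs_def using r by blast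
  qed
qed

lemma openin_strong_topology_open:
  fixes U :: "'a::locally_convex_t2 set"
  assumes "open U"
  shows "openin strong_topology U"
  unfolding openin_strong_topology
proof
  fix x assume x: "x \<in> U"
  have "open ((\<lambda>y. x + y) -` U)" using assms by (intro open_vimage continuous_intros)
  moreover have "0 \<in> (\<lambda>y. x + y) -` U" using x by simp
  ultimately obtain B where "barrel B" "B \<subseteq> (\<lambda>y. x + y) -` U"
    by (rule open_contains_barrel)
  then show "\<exists>B. barrel B \<and> (\<lambda>y. x + y) ` B \<subseteq> U" by blast
qed

lemma bounded_wrt_strong_imp_bounded:
  "bounded_wrt strong_topology S \<Longrightarrow> bounded_wrt euclidean S"
  by (simp add: bounded_wrt_def openin_strong_topology_open)

lemma bounded_wrt_subset:
  assumes "bounded_wrt T S" "S' \<subseteq> S"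
  shows "bounded_wrt T S'"
  using assms unfolding bounded_wrt_def absorbs_def by (meson order_trans)

lemma bounded_wrt_strong_imp_absorbs:
  assumes "bounded_wrt strong_topology S" "barrel B"
  shows "absorbs B S"
proof -
  obtain U where U: "openin strong_topology U" "0 \<in> U" "U \<subseteq> B"
    using assms(2) by (rule barrel_strong_nhd)
  then have "absorbs U S" using assms(1) by (simp add: bounded_wrt_def)
  with U(3) show ?thesis
    unfolding absorbs_def by (meson image_mono order_trans)
qed

text \<open>A barrel that absorbs one slice of the cone contains a smaller slice, by homogeneity.
  \<open>p\<close> is general so as to cover both a single functional and a sum of absolute
  values.\<close>

lemma bounded_slice_in_barrel:
  fixes p :: "'a::locally_convex_t2 \<Rightarrow> real"
  assumes K: "convex_cone K" and p: "\<And>t x. t > 0 \<Longrightarrow> p (t *\<^sub>R x) = t * p x"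
    and bdd: "bounded_wrt strong_topology ({x. p x \<le> l} \<inter> K)" and l: "l > 0" and B: "barrel B"
  obtains \<eta> where "\<eta> > 0" "\<And>k. k \<in> K \<Longrightarrow> p k \<le> \<eta> \<Longrightarrow> k \<in> B"
proof -
  obtain r where r: "r > 0" "{x. p x \<le> l} \<inter> K \<subseteq> (\<lambda>x. r *\<^sub>R x) ` B"
    using bounded_wrt_strong_imp_absorbs[OF bdd B] unfolding absorbs_def
    by (metis abs_of_pos order_refl)
  show thesis
  proof
    show "l / r > 0" using l r(1) by simp
    fix k assume k: "k \<in> K" "p k \<le> l / r"
    then have "r *\<^sub>R k \<in> {x. p x \<le> l} \<inter> K"
      using K r(1) p by (auto simp: convex_cone_iff field_simps)
    then obtain b where "r *\<^sub>R k = r *\<^sub>R b" "b \<in> B" using r(2) by blast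
    then show "k \<in> B" using r(1) by simp
  qed
qed

section \<open>Weak neighbourhoods and convergence in the bidual\<close>

lemma openin_weak_vimage: "open S \<Longrightarrow> openin weak_topology (app f -` S)"
  unfolding weak_topology_def by (intro topology_generated_by_Basis) blast

text \<open>Induction on the generation of the weak topology; an intersection merges the two finite
  families and takes the smaller radius.\<close>

lemma weak_nhd_0:
  assumes "openin weak_topology V" "0 \<in> V"
  obtains I e where "finite I" "e > 0"
    "{x::'a::locally_convex_t2. \<forall>f\<in>I. \<bar>app f x\<bar> \<le> e} \<subseteq> V"
proof -
  have "generate_topology_on {app f -` V | (f :: 'a dual) V. open V} V"
    using assms(1) unfolding weak_topology_def openin_topology_generated_by_iff .
  then have "0 \<in> V \<longrightarrow> (\<exists>I e. finite I \<and> e > 0 \<and> {x::'a. \<forall>f\<in>I. \<bar>app f x\<bar> \<le> e} \<subseteq> V)"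
  proof induction
    case Empty
    then show ?case by simp
  next
    case (Int A B)
    show ?case
    proof
      assume "0 \<in> A \<inter> B"
      then obtain I e I' e' where
        "finite I" "e > 0" "{x::'a. \<forall>f\<in>I. \<bar>app f x\<bar> \<le> e} \<subseteq> A"
        "finite I'" "e' > 0" "{x::'a. \<forall>f\<in>I'. \<bar>app f x\<bar> \<le> e'} \<subseteq> B"
        using Int.IH by blast
      then show "\<exists>I e. finite I \<and> e > 0 \<and> {x::'a. \<forall>f\<in>I. \<bar>app f x\<bar> \<le> e} \<subseteq> A \<inter> B"
        by (intro exI[of _ "I \<union> I'"] exI[of _ "min e e'"]) auto
    qed
  next
    case (UN \<U>)
    show ?case
    proof
      assume "0 \<in> \<Union>\<U>"
      then obtain A where A: "A \<in> \<U>" "0 \<in> A" by blast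
      then obtain I e where "finite I" "e > 0" "{x::'a. \<forall>f\<in>I. \<bar>app f x\<bar> \<le> e} \<subseteq> A"
        using UN.IH by blast
      with A(1) show "\<exists>I e. finite I \<and> e > 0 \<and> {x::'a. \<forall>f\<in>I. \<bar>app f x\<bar> \<le> e} \<subseteq> \<Union>\<U>"
        by blast
    qed
  next
    case (Basis A)
    then obtain f :: "'a dual" and V where A: "A = app f -` V" "open V" by blast
    show ?case
    proof
      assume "0 \<in> A"
      then have "0 \<in> V" using A(1) by (simp add: linear_0[OF linear_app])
      then obtain e where "e > 0" "cball 0 e \<subseteq> V" using A(2) open_contains_cball by blast
      then show "\<exists>I e. finite I \<and> e > 0 \<and> {x::'a. \<forall>f\<in>I. \<bar>app f x\<bar> \<le> e} \<subseteq> A"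
        using A(1) by (intro exI[of _ "{f}"] exI[of _ e]) (auto simp: dist_real_def)
    qed
  qed
  with assms(2) that show thesis by blast
qed

lemma barrel_finite_polar:
  assumes "finite I" "e > 0"
  shows "barrel {x::'a::locally_convex_t2. \<forall>f\<in>I. \<bar>app f x\<bar> \<le> e}"
proof (rule barrel_polar[OF _ assms(2)])
  show "\<exists>M. \<forall>g\<in>I. \<bar>app g x\<bar> \<le> M" for x
    using assms(1) by (intro exI[of _ "\<Sum>g\<in>I. \<bar>app g x\<bar>"] ballI member_le_sum) auto
qed

lemma app_scale: "app f (t *\<^sub>R x) = t * app f x"
  by (simp add: linear_scale[OF linear_app])

lemma app_sum: "app (\<Sum>i\<in>I. g i) x = (\<Sum>i\<in>I. app (g i) x)"
  by (induction I rule: infinite_finite_induct) auto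

lemma canonical_app [simp]: "app (canonical x) f = app f x"
  by (simp add: canonical.rep_eq)

lemma canonical_add: "canonical (x + y) = canonical x + canonical y"
  by (rule app_inject_ext) (simp add: linear_add[OF linear_app])

lemma closure_imp_limit_mem:
  assumes "\<And>n::nat. f n \<in> S" "f \<longlonglongrightarrow> l"
  shows "l \<in> closure S"
  using assms(1) closure_subset[of S]
  by (intro Lim_in_closed_set[OF closed_closure _ _ assms(2)] always_eventually) auto

lemma tendsto_bidual:
  fixes \<phi> :: "'a::locally_convex_t2 dual dual"
  assumes "\<And>S e. bounded_wrt euclidean S \<Longrightarrow> e > 0 \<Longrightarrow>
    eventually (\<lambda>n. \<forall>g\<in>S. \<bar>app (x n) g - app \<phi> g\<bar> < e) F"
  shows "(x \<longlongrightarrow> \<phi>) F"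
  unfolding filterlim_iff
proof (intro allI impI)
  fix P assume "eventually P (nhds \<phi>)"
  then obtain S e where S: "bounded_wrt euclidean S" "e > 0"
    "\<And>g. (\<forall>x\<in>S. \<bar>app g x - app \<phi> x\<bar> < e) \<Longrightarrow> P g"
    unfolding eventually_nhds_dual by blast
  show "eventually (\<lambda>n. P (x n)) F"
    using assms[OF S(1,2)] by (rule eventually_mono) (rule S(3))
qed

text \<open>Evaluation at \<open>x\<close> lies in the bidual, hence is bounded on \<open>S\<close>.
  Thus being eventually in every barrel of the space implies convergence to 0 in the bidual.\<close>

lemma barrel_bounded_polar:
  assumes "bounded_wrt euclidean S" "e > 0"
  shows "barrel {x::'a::locally_convex_t2. \<forall>g\<in>S. \<bar>app g x\<bar> \<le> e}"
proof (rule barrel_polar[OF _ assms(2)])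
  fix x :: 'a
  obtain M where "\<And>g. g \<in> S \<Longrightarrow> \<bar>app (canonical x) g\<bar> < M"
    using app_bounded[OF assms(1)] by blast
  then show "\<exists>M. \<forall>g\<in>S. \<bar>app g x\<bar> \<le> M" by (auto intro: less_imp_le)
qed

lemma bounded_wrt_scaleR:
  fixes c :: real
  assumes S: "bounded_wrt T S" and c: "c > 0"
  shows "bounded_wrt T ((\<lambda>x. c *\<^sub>R x) ` S)"
  unfolding bounded_wrt_def
proof (intro allI impI)
  fix U assume "openin T U \<and> 0 \<in> U"
  then obtain r where r: "r > 0" "\<And>t. r \<le> \<bar>t\<bar> \<Longrightarrow> S \<subseteq> (\<lambda>x. t *\<^sub>R x) ` U"
    using S unfolding bounded_wrt_def absorbs_def by meson
  show "absorbs U ((\<lambda>x. c *\<^sub>R x) ` S)"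
    unfolding absorbs_def
  proof (intro exI conjI allI impI)
    show "r * c > 0" using r(1) c by simp
    fix t assume t: "r * c \<le> \<bar>t\<bar>"
    then have "r \<le> \<bar>t / c\<bar>" using c by (simp add: field_simps)
    then have "S \<subseteq> (\<lambda>x. (t / c) *\<^sub>R x) ` U" by (rule r(2))
    then have "(\<lambda>x. c *\<^sub>R x) ` S \<subseteq> (\<lambda>x. c *\<^sub>R x) ` (\<lambda>x. (t / c) *\<^sub>R x) ` U"
      by (rule image_mono)
    then show "(\<lambda>x. c *\<^sub>R x) ` S \<subseteq> (\<lambda>x. t *\<^sub>R x) ` U" using c by (simp add: image_image)
  qed
qed

subsection \<open>Bounded slices of a cone\<close>

text \<open>In the second case \<open>m\<close> and \<open>n\<close> vary independently, which later
  makes \<open>a\<close> Cauchy, and boundedness of \<open>range a\<close> later makes its limit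
  functional continuous.\<close>

lemma bPC_dichotomy:
  fixes K :: "'a::locally_convex_t2 set"
  assumes K: "convex_cone K" and bPC: "bPC_at_0 K"
  obtains (slice) f l where "f \<in> dual_cone K" "l > 0"
      "bounded_wrt strong_topology ({x. app f x \<le> l} \<inter> K)"
  | (opposite) a b f L where "\<And>n::nat. a n \<in> K" "\<And>n::nat. b n \<in> K"
      "(\<lambda>n. app f (a n)) \<longlonglongrightarrow> L" "L \<noteq> 0" "bounded_wrt strong_topology (range a)"
      "\<And>B. barrel B \<Longrightarrow> \<exists>N. \<forall>m\<ge>N. \<forall>n\<ge>N. a m + b n \<in> B"
proof -
  obtain W V where V: "openin weak_topology V" "0 \<in> V" "V \<subseteq> W"
    and W: "bounded_wrt strong_topology (K \<inter> W)"
    using bPC unfolding bPC_at_0_def by blast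
  obtain I e where I: "finite I" and e: "e > 0" and IV: "{x. \<forall>f\<in>I. \<bar>app f x\<bar> \<le> e} \<subseteq> V"
    using weak_nhd_0[OF V(1,2)] by blast
  define p where "p x = (\<Sum>f\<in>I. \<bar>app f x\<bar>)" for x
  have app_le_p: "\<bar>app f x\<bar> \<le> p x" if "f \<in> I" for f x
    unfolding p_def using I that by (intro member_le_sum) auto
  have p_scale: "p (t *\<^sub>R x) = t * p x" if "t > 0" for t x
    using that by (simp add: p_def linear_scale[OF linear_app] abs_mult sum_distrib_left)
  have "{x. p x \<le> e} \<inter> K \<subseteq> K \<inter> W"
  proof -
    have "x \<in> W" if "p x \<le> e" for x
    proof -
      have "\<forall>f\<in>I. \<bar>app f x\<bar> \<le> e" using app_le_p that order_trans by blast
      then show ?thesis using IV V(3) by blast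
    qed
    then show ?thesis by auto
  qed
  with W have A: "bounded_wrt strong_topology ({x. p x \<le> e} \<inter> K)" by (rule bounded_wrt_subset)
  show thesis
  proof (rule finite_functionals_dichotomy[OF I, of app K])
    show "linear (app f)" for f :: "'a dual" by (rule linear_app)
    show "convex_cone K" by (rule K)
  next
    fix c \<delta> assume \<delta>: "\<delta> > 0"
      and c: "\<And>k. k \<in> K \<Longrightarrow> \<delta> * (\<Sum>f\<in>I. \<bar>app f k\<bar>) \<le> (\<Sum>f\<in>I. c f * app f k)"
    define g where "g = (\<Sum>f\<in>I. c f *\<^sub>R f)"
    have g: "\<delta> * p k \<le> app g k" if "k \<in> K" for k
      using c[OF that] by (simp add: g_def app_sum p_def)
    have "{x. app g x \<le> \<delta> * e} \<inter> K \<subseteq> {x. p x \<le> e} \<inter> K"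
      using g \<delta> by (auto dest!: g) (meson mult_le_cancel_left_pos order_trans)
    then have "bounded_wrt strong_topology ({x. app g x \<le> \<delta> * e} \<inter> K)"
      by (rule bounded_wrt_subset[OF A])
    moreover have "g \<in> dual_cone K"
    proof -
      have "0 \<le> \<delta> * p k" for k using \<delta> by (auto simp: p_def intro!: mult_nonneg_nonneg sum_nonneg)
      then show ?thesis using g order_trans unfolding dual_cone_def by blast
    qed
    ultimately show thesis using \<delta> e by (intro slice[of g "\<delta> * e"]) auto
  next
    fix a b L h assume ab: "\<And>n::nat. a n \<in> K" "\<And>n. b n \<in> K"
      and lim: "\<And>f. f \<in> I \<Longrightarrow> (\<lambda>n. app f (a n)) \<longlonglongrightarrow> L f"
        "\<And>f. f \<in> I \<Longrightarrow> (\<lambda>n. app f (b n)) \<longlonglongrightarrow> - L f"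
      and h: "h \<in> I" "L h \<noteq> 0"
    have "(\<lambda>n. p (a n)) \<longlonglongrightarrow> (\<Sum>f\<in>I. \<bar>L f\<bar>)"
      unfolding p_def by (intro tendsto_sum tendsto_rabs lim)
    then have "bounded (range (\<lambda>n. p (a n)))" by (rule convergent_imp_bounded)
    then obtain M where M: "M > 0" "\<And>n. \<bar>p (a n)\<bar> \<le> M"
      by (auto simp: bounded_pos)
    \<comment> \<open>Convergent coordinates bound \<open>p\<close> along \<open>a\<close>, so one
      dilation by \<open>M / e\<close> of the bounded slice covers the sequence.\<close>
    have a_slice: "range a \<subseteq> (\<lambda>x. (M / e) *\<^sub>R x) ` ({x. p x \<le> e} \<inter> K)"
    proof
      fix x assume "x \<in> range a"
      then obtain n where n: "x = a n" by blast
      have "p ((e / M) *\<^sub>R a n) = e / M * p (a n)" using e M(1) by (intro p_scale) auto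
      also have "\<dots> \<le> e / M * M" using M(2)[of n] e M(1) by (intro mult_left_mono) auto
      finally have "p ((e / M) *\<^sub>R a n) \<le> e" using M(1) by simp
      moreover have "(e / M) *\<^sub>R a n \<in> K" using K ab(1)[of n] e M(1) by (auto simp: convex_cone_iff)
      ultimately show "x \<in> (\<lambda>x. (M / e) *\<^sub>R x) ` ({x. p x \<le> e} \<inter> K)"
        using n e M(1) by (intro image_eqI[where x="(e / M) *\<^sub>R a n"]) auto
    qed
    have bdd_a: "bounded_wrt strong_topology (range a)"
      using bounded_wrt_scaleR[OF A, of "M / e"] e M(1) a_slice by (auto intro: bounded_wrt_subset)
    have "\<exists>N. \<forall>m\<ge>N. \<forall>n\<ge>N. a m + b n \<in> B" if B: "barrel B" for B
    proof -
      obtain \<eta> where \<eta>: "\<eta> > 0" "\<And>k. k \<in> K \<Longrightarrow> p k \<le> \<eta> \<Longrightarrow> k \<in> B"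
        using bounded_slice_in_barrel[OF K p_scale A e B] by blast
      \<comment> \<open>The product filter expresses the joint limit in \<open>m\<close> and
        \<open>n\<close>; the limit is 0 because \<open>L f\<close> and \<open>- L f\<close>
        cancel.\<close>
      have "((\<lambda>q. p (a (fst q) + b (snd q))) \<longlongrightarrow> (\<Sum>f\<in>I. \<bar>L f + - L f\<bar>)) (sequentially \<times>\<^sub>F sequentially)"
        unfolding p_def linear_add[OF linear_app]
        by (intro tendsto_sum tendsto_rabs tendsto_add
            filterlim_compose[OF lim(1) filterlim_fst] filterlim_compose[OF lim(2) filterlim_snd])
      then have "eventually (\<lambda>q. p (a (fst q) + b (snd q)) < \<eta>) (sequentially \<times>\<^sub>F sequentially)"
        using \<eta>(1) by (intro order_tendstoD(2)) auto
      then obtain P Q where "eventually P sequentially" "eventually Q sequentially"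
        "\<And>m n. P m \<Longrightarrow> Q n \<Longrightarrow> p (a m + b n) < \<eta>"
        unfolding eventually_prod_filter by auto
      then obtain N where N: "\<And>m n. m \<ge> N \<Longrightarrow> n \<ge> N \<Longrightarrow> p (a m + b n) < \<eta>"
        unfolding eventually_sequentially by (metis le_cases order_trans)
      show ?thesis
        using N ab K by (intro exI[of _ N] allI impI \<eta>(2)) (auto simp: convex_cone_iff intro: less_imp_le)
    qed
    with ab lim(1)[OF h(1)] h(2) bdd_a show thesis by (rule opposite)
  qed
qed

section \<open>What an opposite pair of sequences excludes\<close>

text \<open>The midpoints of \<open>a n\<close> and \<open>b n\<close> tend to 0, while
  \<open>f\<close> keeps \<open>a\<close> from tending weakly to 0.
  \<open>weak_s_ext_at_0_net\<close> admits nets indexed by \<open>nat\<close>.\<close>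

lemma opposite_not_weak_s_ext:
  fixes K :: "'a::locally_convex_t2 set"
  assumes ab: "\<And>n::nat. a n \<in> K" "\<And>n::nat. b n \<in> K"
    and f: "(\<lambda>n. app f (a n)) \<longlonglongrightarrow> L" "L \<noteq> 0"
    and sum: "\<And>B. barrel B \<Longrightarrow> \<exists>N. \<forall>m\<ge>N. \<forall>n\<ge>N. a m + b n \<in> B"
  shows "\<not> weak_s_ext_at_0 K"
proof
  assume K: "weak_s_ext_at_0 K"
  have dir: "directed_preorder (UNIV :: nat set) (\<le>)"
    unfolding directed_preorder_def by (auto, metis nat_le_linear)
  have "net_converges euclidean UNIV (\<le>) (\<lambda>n. (1/2::real) *\<^sub>R (a n + b n)) 0"
    unfolding net_converges_def
  proof (intro allI impI)
    fix U :: "'a set" assume "openin euclidean U \<and> 0 \<in> U"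
    then obtain B where B: "barrel B" "B \<subseteq> U" using open_contains_barrel by auto
    then obtain N where N: "\<And>n. n \<ge> N \<Longrightarrow> a n + b n \<in> B" using sum by blast
    have "(1/2::real) *\<^sub>R x \<in> B" if "x \<in> B" for x
      using B(1) that unfolding barrel_def balanced_def by auto
    then show "\<exists>i\<in>UNIV. \<forall>j\<in>UNIV. i \<le> j \<longrightarrow> (1/2::real) *\<^sub>R (a j + b j) \<in> U"
      using N B(2) by blast
  qed
  then have conv: "net_converges weak_topology UNIV (\<le>) a 0"
    using ab by (intro weak_s_ext_at_0_net[OF K dir, of a b]) auto
  have "(\<lambda>n. app f (a n)) \<longlonglongrightarrow> 0"
    unfolding tendsto_def
  proof (intro allI impI)
    fix S :: "real set" assume S: "open S" "0 \<in> S"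
    then have "openin weak_topology (app f -` S)" by (intro openin_weak_vimage)
    moreover have "0 \<in> app f -` S" using S(2) by (simp add: linear_0[OF linear_app])
    ultimately show "eventually (\<lambda>n. app f (a n) \<in> S) sequentially"
      using conv unfolding net_converges_def eventually_sequentially by fastforce
  qed
  then show False using f LIMSEQ_unique by blast
qed

text \<open>The pointwise limit of \<open>a\<close> is shown to be a nonzero element of the bidual
  such that it and its negative both lie in the closure.\<close>

lemma opposite_closure_not_pointed:
  fixes K :: "'a::locally_convex_t2 set"
  assumes ab: "\<And>n::nat. a n \<in> K" "\<And>n::nat. b n \<in> K"
    and f: "(\<lambda>n. app f (a n)) \<longlonglongrightarrow> L" "L \<noteq> 0"
    and bdd: "bounded_wrt strong_topology (range a)"
    and sum: "\<And>B. barrel B \<Longrightarrow> \<exists>N. \<forall>m\<ge>N. \<forall>n\<ge>N. a m + b n \<in> B"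
  shows "\<not> pointed (closure (canonical ` K))"
proof
  assume "pointed (closure (canonical ` K))"
  have Cauchy_unif: "\<exists>N. \<forall>g\<in>S. \<forall>m\<ge>N. \<forall>n\<ge>N. \<bar>app g (a m) - app g (a n)\<bar> \<le> e"
    if S: "bounded_wrt euclidean S" and e: "e > 0" for S e
  proof -
    have "barrel {x::'a. \<forall>g\<in>S. \<bar>app g x\<bar> \<le> e / 2}"
      using S e by (intro barrel_bounded_polar) auto
    then obtain N where N: "\<And>m n g. m \<ge> N \<Longrightarrow> n \<ge> N \<Longrightarrow> g \<in> S \<Longrightarrow> \<bar>app g (a m + b n)\<bar> \<le> e / 2"
      using sum by fastforce
    \<comment> \<open>Both \<open>a m\<close> and \<open>a n\<close> are compared with the same term
      \<open>b N\<close>, which cancels in the difference.\<close>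
    have "\<bar>app g (a m) - app g (a n)\<bar> \<le> e" if "g \<in> S" "m \<ge> N" "n \<ge> N" for g m n
      using N[OF that(2) order_refl that(1)] N[OF that(3) order_refl that(1)]
      unfolding linear_add[OF linear_app] by arith
    then show ?thesis by blast
  qed
  have conv: "convergent (\<lambda>n. app g (a n))" for g
  proof -
    have "\<exists>N. \<forall>m\<ge>N. \<forall>n\<ge>N. dist (app g (a m)) (app g (a n)) < e" if "e > 0" for e
    proof -
      obtain N where "\<forall>m\<ge>N. \<forall>n\<ge>N. \<bar>app g (a m) - app g (a n)\<bar> \<le> e / 2"
        using Cauchy_unif[OF bounded_wrt_singleton[of g], of "e / 2"] \<open>e > 0\<close> by auto
      then show ?thesis using \<open>e > 0\<close> unfolding dist_real_def
        by (intro exI[of _ N]) fastforce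
    qed
    then show ?thesis unfolding Cauchy_convergent_iff[symmetric] by (rule metric_CauchyI)
  qed
  define \<phi> where "\<phi> g = lim (\<lambda>n. app g (a n))" for g
  have \<phi>: "(\<lambda>n. app g (a n)) \<longlonglongrightarrow> \<phi> g" for g
    using conv by (simp add: \<phi>_def convergent_LIMSEQ_iff)
  have lin: "linear \<phi>"
  proof (rule linearI)
    show "\<phi> (g + h) = \<phi> g + \<phi> h" for g h
      using LIMSEQ_unique[OF \<phi>[of "g + h"]] tendsto_add[OF \<phi>[of g] \<phi>[of h]] by simp
    show "\<phi> (r *\<^sub>R g) = r *\<^sub>R \<phi> g" for r g
      using LIMSEQ_unique[OF \<phi>[of "r *\<^sub>R g"]] tendsto_mult_left[OF \<phi>[of g]] by simp
  qed
  \<comment> \<open>Functionals uniformly close on the bounded set \<open>range a\<close> have close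
    limits along \<open>a\<close>.\<close>
  have "isCont \<phi> g" for g
    unfolding continuous_at tendsto_iff
  proof (intro allI impI)
    fix e :: real assume e: "e > 0"
    have "dist (\<phi> h) (\<phi> g) < e" if h: "\<forall>x\<in>range a. \<bar>app h x - app g x\<bar> < e / 2" for h
    proof -
      have "\<bar>\<phi> h - \<phi> g\<bar> \<le> e / 2"
        by (rule LIMSEQ_le_const2[OF tendsto_rabs[OF tendsto_diff[OF \<phi> \<phi>]]])
          (use h in \<open>auto intro: less_imp_le\<close>)
      then show ?thesis using e by (simp add: dist_real_def)
    qed
    then have "eventually (\<lambda>h. dist (\<phi> h) (\<phi> g) < e) (nhds g)"
      unfolding eventually_nhds_dual using e bounded_wrt_strong_imp_bounded[OF bdd]
      by (intro exI[of _ "range a"] exI[of _ "e / 2"]) auto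
    then show "eventually (\<lambda>h. dist (\<phi> h) (\<phi> g) < e) (at g)"
      by (simp add: eventually_at_filter eventually_mono)
  qed
  then have "continuous_on UNIV \<phi>" by (simp add: continuous_at_imp_continuous_on)
  with lin have app_\<phi>: "app (Dual \<phi>) = \<phi>" by (simp add: Dual_inverse)
  \<comment> \<open>Fixing one index of the uniform Cauchy estimate and letting the other tend to
    infinity upgrades pointwise to uniform convergence on bounded sets.\<close>
  have lim_a: "(\<lambda>n. canonical (a n)) \<longlonglongrightarrow> Dual \<phi>"
  proof (rule tendsto_bidual)
    fix S :: "'a dual set" and e :: real assume S: "bounded_wrt euclidean S" and e: "e > 0"
    then obtain N where N: "\<And>g m n. g \<in> S \<Longrightarrow> m \<ge> N \<Longrightarrow> n \<ge> N \<Longrightarrow> \<bar>app g (a m) - app g (a n)\<bar> \<le> e / 2"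
      using Cauchy_unif[OF S, of "e / 2"] by auto
    have "\<bar>app g (a m) - \<phi> g\<bar> \<le> e / 2" if "g \<in> S" "m \<ge> N" for g m
      by (rule LIMSEQ_le_const2[OF tendsto_rabs[OF tendsto_diff[OF tendsto_const \<phi>]]])
        (use N that in blast)
    then show "eventually (\<lambda>n. \<forall>g\<in>S. \<bar>app (canonical (a n)) g - app (Dual \<phi>) g\<bar> < e) sequentially"
      unfolding eventually_sequentially app_\<phi> using e by (intro exI[of _ N]) fastforce
  qed
  have lim_sum: "(\<lambda>n. canonical (a n + b n)) \<longlonglongrightarrow> 0"
  proof (rule tendsto_bidual)
    fix S :: "'a dual set" and e :: real assume S: "bounded_wrt euclidean S" and e: "e > 0"
    then have "barrel {x::'a. \<forall>g\<in>S. \<bar>app g x\<bar> \<le> e / 2}" by (intro barrel_bounded_polar) auto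
    then obtain N where "\<forall>n\<ge>N. \<forall>g\<in>S. \<bar>app g (a n + b n)\<bar> \<le> e / 2" using sum by fastforce
    then show "eventually (\<lambda>n. \<forall>g\<in>S. \<bar>app (canonical (a n + b n)) g - app 0 g\<bar> < e) sequentially"
      unfolding eventually_sequentially using e by (intro exI[of _ N]) fastforce
  qed
  have lim_b: "(\<lambda>n. canonical (b n)) \<longlonglongrightarrow> - Dual \<phi>"
    using tendsto_diff[OF lim_sum lim_a] by (simp add: canonical_add)
  have "Dual \<phi> \<in> closure (canonical ` K)" "- Dual \<phi> \<in> closure (canonical ` K)"
    by (rule closure_imp_limit_mem[OF _ lim_a], simp add: ab,
        rule closure_imp_limit_mem[OF _ lim_b], simp add: ab)
  then have "Dual \<phi> \<in> closure (canonical ` K) \<inter> uminus ` closure (canonical ` K)"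
    by (auto intro: image_eqI[where x="- Dual \<phi>"])
  then have "Dual \<phi> = 0"
    using \<open>pointed _\<close> unfolding pointed_def by blast
  then have "\<phi> f = 0" using app_\<phi> by (metis zero_dual.rep_eq)
  moreover have "\<phi> f = L" using LIMSEQ_unique[OF \<phi> f(1)] .
  ultimately show False using f(2) by simp
qed

section \<open>Consequences of a bounded slice\<close>

lemma slice_imp_bPC:
  assumes "l > 0" "bounded_wrt strong_topology ({x. app f x \<le> l} \<inter> K)"
  shows "bPC_at_0 K"
  unfolding bPC_at_0_def
proof (intro exI conjI)
  show "openin weak_topology (app f -` {..<l})"
    by (intro openin_weak_vimage open_lessThan)
  show "0 \<in> app f -` {..<l}" using assms(1) by (simp add: linear_0[OF linear_app])
  show "bounded_wrt strong_topology (K \<inter> app f -` {..<l})"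
    using assms(2) by (rule bounded_wrt_subset) auto
qed (rule order_refl)

text \<open>On \<open>K\<close>, \<open>g\<close> is at most \<open>f\<close> divided by
  \<open>\<eta>\<close>, so this multiple of \<open>f\<close> and its difference with
  \<open>g\<close> are both in the dual cone.\<close>

lemma slice_imp_dual_eq_diff:
  fixes K :: "'a::locally_convex_t2 set"
  assumes K: "convex_cone K" and f: "f \<in> dual_cone K" and l: "l > 0"
    and bdd: "bounded_wrt strong_topology ({x. app f x \<le> l} \<inter> K)"
  shows "\<exists>h\<in>dual_cone K. \<exists>h'\<in>dual_cone K. g = h - h'"
proof -
  have "barrel {x. \<forall>h\<in>{g}. \<bar>app h x\<bar> \<le> 1}" by (rule barrel_finite_polar) auto
  then obtain \<eta> where \<eta>: "\<eta> > 0"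
    "\<And>k. k \<in> K \<Longrightarrow> app f k \<le> \<eta> \<Longrightarrow> k \<in> {x. \<forall>h\<in>{g}. \<bar>app h x\<bar> \<le> 1}"
    using bounded_slice_in_barrel[OF K app_scale bdd l] by blast
  have "app g k \<le> app f k / \<eta>" if k: "k \<in> K" for k
  proof (rule field_le_epsilon)
    fix e :: real assume e: "e > 0"
    have "app f k \<ge> 0" using f k by (simp add: dual_cone_def)
    \<comment> \<open>Adding \<open>e\<close> keeps the divisor \<open>c\<close> positive even when
      \<open>app f k = 0\<close>.\<close>
    define c where "c = app f k / \<eta> + e"
    have c: "c > 0" "app f k \<le> \<eta> * c"
      using \<eta>(1) e \<open>app f k \<ge> 0\<close> by (auto simp: c_def algebra_simps intro!: add_pos_nonneg)
    have "inverse c *\<^sub>R k \<in> K" using K k c(1) by (auto simp: convex_cone_iff)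
    moreover have "app f (inverse c *\<^sub>R k) \<le> \<eta>"
      using c by (simp add: linear_scale[OF linear_app] field_simps)
    ultimately have "\<bar>app g (inverse c *\<^sub>R k)\<bar> \<le> 1" using \<eta>(2) by blast
    then have "app g k \<le> c" using c(1) by (simp add: app_scale abs_mult field_simps)
    then show "app g k \<le> app f k / \<eta> + e" by (simp add: c_def)
  qed
  then have "(1 / \<eta>) *\<^sub>R f - g \<in> dual_cone K" by (simp add: dual_cone_def)
  moreover have "(1 / \<eta>) *\<^sub>R f \<in> dual_cone K" using f \<eta>(1) by (simp add: dual_cone_def)
  ultimately show ?thesis
    by (intro bexI[of _ "(1 / \<eta>) *\<^sub>R f"] bexI[of _ "(1 / \<eta>) *\<^sub>R f - g"]) auto
qed

text \<open>Since \<open>f\<close> is nonnegative on \<open>K\<close>, its value at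
  \<open>c j\<close> is at most that at \<open>c j + c' j\<close>, and small values of
  \<open>f\<close> on \<open>K\<close> force membership in any finite polar.\<close>

lemma slice_imp_weak_s_ext:
  fixes K :: "'a::locally_convex_t2 set"
  assumes K: "convex_cone K" and f: "f \<in> dual_cone K" and l: "l > 0"
    and bdd: "bounded_wrt strong_topology ({x. app f x \<le> l} \<inter> K)"
  shows "weak_s_ext_at_0 K"
  unfolding weak_s_ext_at_0_def
proof (intro allI impI)
  fix \<Gamma> :: "'a set set" and le c c'
  assume c: "\<forall>i\<in>\<Gamma>. c i \<in> K \<and> c' i \<in> K"
    and lim: "net_converges euclidean \<Gamma> le (\<lambda>i. (1/2::real) *\<^sub>R (c i + c' i)) 0"
  show "net_converges weak_topology \<Gamma> le c 0"
    unfolding net_converges_def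
  proof (intro allI impI)
    fix U :: "'a set" assume "openin weak_topology U \<and> 0 \<in> U"
    then have U: "openin weak_topology U" "0 \<in> U" by auto
    obtain I e where I: "finite I" "e > 0" "{x. \<forall>f\<in>I. \<bar>app f x\<bar> \<le> e} \<subseteq> U"
      using U by (rule weak_nhd_0)
    obtain \<eta> where \<eta>: "\<eta> > 0"
      "\<And>k. k \<in> K \<Longrightarrow> app f k \<le> \<eta> \<Longrightarrow> k \<in> {x. \<forall>f\<in>I. \<bar>app f x\<bar> \<le> e}"
      using bounded_slice_in_barrel[OF K app_scale bdd l barrel_finite_polar[OF I(1,2)]] by blast
    have "open (app f -` {..<\<eta> / 2})" by (intro open_vimage continuous_on_app) auto
    moreover have "0 \<in> app f -` {..<\<eta> / 2}" using \<eta>(1) by (simp add: linear_0[OF linear_app])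
    ultimately obtain i where i: "i \<in> \<Gamma>"
      "\<And>j. j \<in> \<Gamma> \<Longrightarrow> le i j \<Longrightarrow> app f ((1/2::real) *\<^sub>R (c j + c' j)) < \<eta> / 2"
      using lim unfolding net_converges_def by auto
    have "c j \<in> U" if j: "j \<in> \<Gamma>" "le i j" for j
    proof (rule subsetD[OF I(3)], rule \<eta>(2))
      show "c j \<in> K" using c j(1) by blast
      have "app f (c' j) \<ge> 0" using f c j(1) by (auto simp: dual_cone_def)
      then show "app f (c j) \<le> \<eta>"
        using i(2)[OF j] by (simp add: linear_scale[OF linear_app] linear_add[OF linear_app])
    qed
    then show "\<exists>i\<in>\<Gamma>. \<forall>j\<in>\<Gamma>. le i j \<longrightarrow> c j \<in> U" using i(1) by blast
  qed
qed

section \<open>Pointedness in the bidual\<close>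

lemma closed_dual_cone: "closed (dual_cone (S :: 'a::locally_convex_t2 dual set))"
proof -
  have "dual_cone S = (\<Inter>k\<in>S. (\<lambda>f. app f k) -` {0..})" by (auto simp: dual_cone_def)
  moreover have "continuous_on UNIV (\<lambda>f. app f k)" for k :: "'a dual"
    using continuous_on_app[of "canonical k"] by simp
  ultimately show ?thesis by (simp add: closed_INT closed_vimage)
qed

text \<open>If \<open>\<phi>\<close> and \<open>- \<phi>\<close> are both nonnegative on the dual
  cone, \<open>\<phi>\<close> vanishes there, then on the span by linearity and on its closure by
  continuity.\<close>

lemma pointed_bidual_cone:
  fixes K :: "'a::locally_convex_t2 set"
  assumes "closure (span (dual_cone K)) = UNIV"
  shows "pointed (dual_cone (dual_cone K))"
proof -
  have "\<phi> = 0" if \<phi>: "\<phi> \<in> dual_cone (dual_cone K)" "- \<phi> \<in> dual_cone (dual_cone K)" for \<phi>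
  proof (rule app_inject_ext)
    fix g
    have "app \<phi> h = 0" if "h \<in> dual_cone K" for h
      using \<phi> that by (fastforce simp: dual_cone_def)
    then have "app \<phi> h = 0" if "h \<in> span (dual_cone K)" for h
      using linear_eq_0_on_span[OF linear_app] that by blast
    then have "app \<phi> ` span (dual_cone K) \<subseteq> {0}" by auto
    then have "app \<phi> ` closure (span (dual_cone K)) \<subseteq> {0}"
      using continuous_on_app[of \<phi>] continuous_on_subset by (intro image_closure_subset) blast+
    then show "app \<phi> g = app 0 g" using assms by auto
  qed
  then show ?thesis
    unfolding pointed_def by (auto simp: dual_cone_def image_iff)
qed

text \<open>The bidual cone is closed and contains the image of \<open>K\<close>, so it contains the
  closure, which inherits pointedness because it contains 0.\<close>

lemma pointed_canonical_closure:
  fixes K :: "'a::locally_convex_t2 set"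
  assumes K: "0 \<in> K" and "pointed (dual_cone (dual_cone K))"
  shows "pointed (closure (canonical ` K))"
proof -
  have "canonical ` K \<subseteq> dual_cone (dual_cone K)" by (auto simp: dual_cone_def)
  then have sub: "closure (canonical ` K) \<subseteq> dual_cone (dual_cone K)"
    by (intro closure_minimal closed_dual_cone)
  have "canonical 0 = (0 :: 'a dual dual)"
    by (rule app_inject_ext) (simp add: linear_0[OF linear_app])
  then have "0 \<in> closure (canonical ` K)" using K closure_subset by (metis imageI subsetD)
  then have "0 \<in> closure (canonical ` K) \<inter> uminus ` closure (canonical ` K)"
    by (auto intro: image_eqI[where x=0])
  then show ?thesis using assms(2) sub unfolding pointed_def by blast
qed

text \<open>On \<open>K\<close> the sum of the nonnegative functionals dominates each of them; the
  level \<open>l / 2\<close> turns the weak inequality into a strict one.\<close>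

lemma finite_slices_imp_slice:
  fixes K :: "'a::locally_convex_t2 set" and f :: "'i \<Rightarrow> 'a dual"
  assumes I: "finite I" "\<And>j. j \<in> I \<Longrightarrow> f j \<in> dual_cone K"
    and bdd: "bounded_wrt strong_topology ((\<Inter>j\<in>I. {x. app (f j) x < l}) \<inter> K)" and l: "l > 0"
  shows "\<exists>g\<in>dual_cone K. \<exists>l>0. bounded_wrt strong_topology ({x. app g x \<le> l} \<inter> K)"
proof (intro bexI exI conjI)
  let ?g = "\<Sum>j\<in>I. f j"
  show "l / 2 > 0" using l by simp
  show "?g \<in> dual_cone K" using I(2) by (auto simp: dual_cone_def app_sum intro!: sum_nonneg)
  have "app (f j) x < l" if "x \<in> K" "app ?g x \<le> l / 2" "j \<in> I" for x j
  proof -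
    have "app (f j) x \<le> app ?g x"
      unfolding app_sum using I that by (intro member_le_sum) (auto simp: dual_cone_def)
    then show ?thesis using that(2) l by linarith
  qed
  then show "bounded_wrt strong_topology ({x. app ?g x \<le> l / 2} \<inter> K)"
    by (intro bounded_wrt_subset[OF bdd]) auto
qed

section \<open>Equivalence of the six conditions\<close>

theorem theorem3p13:
  fixes K :: "'a::locally_convex_t2 set"
  assumes "infrabarreled TYPE('a)" and "convex_cone K" and "pointed K"
  shows "let
      i = (\<exists>f\<in>dual_cone K. \<exists>l>0. bounded_wrt strong_topology ({x. app f x \<le> l} \<inter> K));
      ii = (bPC_at_0 K \<and> pointed (closure (canonical ` K)));
      iii = (bPC_at_0 K \<and> weak_s_ext_at_0 K);
      iv = (bPC_at_0 K \<and> pointed (dual_cone (dual_cone K)));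
      v = (bPC_at_0 K \<and> closure (span (dual_cone K)) = UNIV);
      vi = (\<exists>n\<ge>1. \<exists>f::nat \<Rightarrow> 'a dual. (\<forall>j\<in>{1..n}. f j \<in> dual_cone K) \<and>
        (\<exists>l>0. bounded_wrt strong_topology ((\<Inter>j\<in>{1..n}. {x. app (f j) x < l}) \<inter> K)))
    in (i \<longleftrightarrow> ii) \<and> (i \<longleftrightarrow> iii) \<and> (i \<longleftrightarrow> iv) \<and> (i \<longleftrightarrow> v) \<and> (i \<longleftrightarrow> vi)"
proof -
  note K = assms(2)
  define i ii iii iv v vi where
    "i \<longleftrightarrow> (\<exists>f\<in>dual_cone K. \<exists>l>0. bounded_wrt strong_topology ({x. app f x \<le> l} \<inter> K))"
    and "ii \<longleftrightarrow> bPC_at_0 K \<and> pointed (closure (canonical ` K))"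
    and "iii \<longleftrightarrow> bPC_at_0 K \<and> weak_s_ext_at_0 K"
    and "iv \<longleftrightarrow> bPC_at_0 K \<and> pointed (dual_cone (dual_cone K))"
    and "v \<longleftrightarrow> bPC_at_0 K \<and> closure (span (dual_cone K)) = UNIV"
    and "vi \<longleftrightarrow> (\<exists>n\<ge>1. \<exists>f::nat \<Rightarrow> 'a dual. (\<forall>j\<in>{1..n}. f j \<in> dual_cone K) \<and>
        (\<exists>l>0. bounded_wrt strong_topology ((\<Inter>j\<in>{1..n}. {x. app (f j) x < l}) \<inter> K)))"
  note defs = this
  \<comment> \<open>The cycle \<open>i\<close>, \<open>v\<close>, \<open>iv\<close>,
    \<open>ii\<close>, \<open>i\<close> settles four conditions; \<open>iii\<close> and
    \<open>vi\<close> are each tied to \<open>i\<close> directly.\<close>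
  have "i \<Longrightarrow> v"
  proof -
    assume i
    then obtain f l where f: "f \<in> dual_cone K" "l > 0"
      "bounded_wrt strong_topology ({x. app f x \<le> l} \<inter> K)" unfolding i_def by blast
    have "g \<in> span (dual_cone K)" for g
      using slice_imp_dual_eq_diff[OF K f, of g] by (auto intro: span_diff span_base)
    then have "span (dual_cone K) = UNIV" by blast
    with slice_imp_bPC[OF f(2,3)] show v by (simp add: v_def)
  qed
  moreover have "v \<Longrightarrow> iv" unfolding v_def iv_def using pointed_bidual_cone by blast
  moreover have "iv \<Longrightarrow> ii" unfolding iv_def ii_def
    using pointed_canonical_closure K by (auto simp: convex_cone_iff)
  moreover have "ii \<Longrightarrow> i"
  proof -
    assume ii
    then have ii: "bPC_at_0 K" "pointed (closure (canonical ` K))" by (auto simp: ii_def)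
    show i using K ii(1)
      by (cases rule: bPC_dichotomy) (use ii(2) opposite_closure_not_pointed in \<open>unfold i_def, blast+\<close>)
  qed
  moreover have "iii \<Longrightarrow> i"
  proof -
    assume iii
    then have iii: "bPC_at_0 K" "weak_s_ext_at_0 K" by (auto simp: iii_def)
    show i using K iii(1)
      by (cases rule: bPC_dichotomy) (use iii(2) opposite_not_weak_s_ext in \<open>unfold i_def, blast+\<close>)
  qed
  moreover have "i \<Longrightarrow> iii" unfolding i_def iii_def
    using slice_imp_bPC slice_imp_weak_s_ext[OF K] by blast
  moreover have "vi \<Longrightarrow> i" unfolding vi_def i_def
    using finite_slices_imp_slice[where I="{1.._}"] by (metis finite_atLeastAtMost)
  moreover have "i \<Longrightarrow> vi"
  proof -
    assume i
    then obtain f l where f: "f \<in> dual_cone K" "l > 0"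
      "bounded_wrt strong_topology ({x. app f x \<le> l} \<inter> K)" unfolding i_def by blast
    have "bounded_wrt strong_topology ((\<Inter>j\<in>{1..1::nat}. {x. app f x < l}) \<inter> K)"
      using f(3) by (rule bounded_wrt_subset) auto
    with f show vi unfolding vi_def
      by (intro exI[of _ "1::nat"] conjI exI[of _ "\<lambda>_. f"] exI[of _ l]) auto
  qed
  ultimately have "(i \<longleftrightarrow> ii) \<and> (i \<longleftrightarrow> iii) \<and> (i \<longleftrightarrow> iv) \<and> (i \<longleftrightarrow> v) \<and> (i \<longleftrightarrow> vi)" by blast
  then show ?thesis unfolding Let_def defs .
qed

end
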